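(* Let $\mathcal{M}$ be a positroid of rank $d$ on $[n]$ without loops or coloops, and let $\pi$ be its associated (fixed-point-free) decorated permutation. Then the independent set polytope $P_{\mathcal{M}}\subset\mathbb{R}^n$ is exactly the set of points $x\in\mathbb{R}^n$ satisfying the inequalities $x_i\ge 0$ for each $i\in[n]$ and the inequalities $$\sum_{l\in E}x_l\le d-\operatorname{ccw}(E^c)$$ for all nonempty subsets $E\subseteq[n]$ whose complement $E^c=[n]\setminus E$ is covered by CCW-arrows of $\pi$.
   Context: A positroid of rank $d$ on $[n]=\{1,\dots,n\}$ is a matroid whose bases are the column sets of the nonzero maximal minors of some real $d\times n$ matrix of rank $d$ all of whose maximal minors are nonnegative. The cyclically shifted order $<_i$ on $[n]$ is $i<_i i+1<_i\cdots<_i n<_i 1<_i\cdots<_i i-1$. For $a,b\in[n]$ the cyclic interval is $[a,b]=\{x\in[n]: x\le_a b\}$ (nonempty; $[a,a-1]=[n]$, indices mod $n$). Decorated permutation of a loopless and coloopless positroid $\mathcal{M}$ with rank function $\operatorname{rk}$: it is the permutation $\pi$ of $[n]$ (without fixed points) for which $\pi(i)$ is the first element $j$ in the list $i+1,i+2,\dots,i-1$ (cyclically) such that $\operatorname{rk}(\{i,i+1,\dots,j\})=\operatorname{rk}(\{i+1,\dots,j\})$. A CCW-arrow of $\pi$ is a cyclic interval of the form $[x,\pi^{-1}(x)]$, one for each $x\in[n]$. For $S\subseteq[n]$, $\operatorname{ccw}(S)$ is the number of $x\in[n]$ with $[x,\pi^{-1}(x)]\subseteq S$. A set $S\subseteq[n]$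 is covered by CCW-arrows of $\pi$ if each element of $S$ is contained in some CCW-arrow of $\pi$ that is itself contained in $S$ (vacuously true for $S=\emptyset$). The independent set polytope is $P_{\mathcal{M}}=\operatorname{conv}\{e_I : I \text{ an independent set of }\mathcal{M}\}$ with $e_I=\sum_{i\in I}e_i$, where $e_1,\dots,e_n$ is the standard basis of $\mathbb{R}^n$. *)

theory Defs
  imports "HOL-Analysis.Analysis"
begin

text \<open>
  The ground set \<open>[n]\<close> is a type \<open>'n\<close> of sort \<open>{finite, linorder}\<close> with \<open>n = CARD('n)\<close>: a finite
  linear order is isomorphic to \<open>1 < \<dots> < n\<close> in exactly one way. Likewise the rows of a
  \<open>d \<times> n\<close> matrix are indexed by a finite linear order \<open>'d\<close> with \<open>d = CARD('d)\<close>.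
\<close>

section \<open>Matroids, given by their bases\<close>

definition matroid_bases :: "'a::finite set set \<Rightarrow> bool" where
  "matroid_bases \<B> \<longleftrightarrow> \<B> \<noteq> {} \<and>
     (\<forall>B\<in>\<B>. \<forall>C\<in>\<B>. \<forall>b\<in>B - C. \<exists>c\<in>C - B. insert c (B - {b}) \<in> \<B>)"

definition indep :: "'a set set \<Rightarrow> 'a set \<Rightarrow> bool" where
  "indep \<B> I \<longleftrightarrow> (\<exists>B\<in>\<B>. I \<subseteq> B)"

definition rk :: "'a::finite set set \<Rightarrow> 'a set \<Rightarrow> nat" where
  "rk \<B> S = Max (card ` {I. I \<subseteq> S \<and> indep \<B> I})"

definition loop :: "'a set set \<Rightarrow> 'a \<Rightarrow> bool" where
  "loop \<B> i \<longleftrightarrow> (\<forall>B\<in>\<B>. i \<notin> B)"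

definition coloop :: "'a set set \<Rightarrow> 'a \<Rightarrow> bool" where
  "coloop \<B> i \<longleftrightarrow> (\<forall>B\<in>\<B>. i \<in> B)"

definition independent_set_polytope :: "'n::finite set set \<Rightarrow> (real ^ 'n) set" where
  "independent_set_polytope \<B> = convex hull {(\<Sum>i\<in>I. axis i 1) | I. indep \<B> I}"

section \<open>Positroids\<close>

text \<open>
  A \<open>d\<close>-subset \<open>J\<close> of the columns corresponds to its increasing enumeration \<open>f :: 'd \<Rightarrow> 'n\<close>, the
  unique strictly monotone map with range \<open>J\<close>. The maximal minor at \<open>J\<close> thus takes the columns
  in increasing order, which fixes its sign.
\<close>
definition maximal_minor :: "real ^ 'n ^ 'd \<Rightarrow> ('d::finite \<Rightarrow> 'n::finite) \<Rightarrow> real" where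
  "maximal_minor A f = det (\<chi> r c. A $ r $ f c)"

text \<open>The type argument carries the rank: \<open>positroid TYPE('d) \<B>\<close> says that \<open>\<B>\<close> is the set of
  bases of a positroid of rank \<open>CARD('d)\<close>.\<close>
definition positroid ::
    "'d::{finite,linorder} itself \<Rightarrow> 'n::{finite,linorder} set set \<Rightarrow> bool" where
  "positroid _ \<B> \<longleftrightarrow> matroid_bases \<B> \<and>
     (\<exists>A :: ((real, 'n) vec, 'd) vec.
        rank A = CARD('d) \<and>
        (\<forall>f. strict_mono f \<longrightarrow> maximal_minor A f \<ge> 0) \<and>
        \<B> = {range f | f. strict_mono f \<and> maximal_minor A f \<noteq> 0})"

section \<open>Cyclic intervals and decorated permutations\<close>

text \<open>The cyclically shifted order \<open>a <\<^sub>a a+1 <\<^sub>a \<dots> <\<^sub>a n <\<^sub>a 1 <\<^sub>a \<dots> <\<^sub>a a-1\<close>: the elements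
  \<open>\<ge> a\<close> come before those \<open>< a\<close>, and each of these two blocks keeps its order.\<close>
definition cyclic_le :: "'n::linorder \<Rightarrow> 'n \<Rightarrow> 'n \<Rightarrow> bool" where
  "cyclic_le a x y \<longleftrightarrow> (a \<le> x \<and> y < a) \<or> ((a \<le> x \<longleftrightarrow> a \<le> y) \<and> x \<le> y)"

definition cyclic_interval :: "'n::linorder \<Rightarrow> 'n \<Rightarrow> 'n set" where
  "cyclic_interval a b = {x. cyclic_le a x b}"

text \<open>The list \<open>i+1, \<dots>, i-1\<close> consists of the \<open>j \<noteq> i\<close> in the order \<open><\<^sub>i\<close>, and for such \<open>j\<close> the set
  \<open>{i+1, \<dots>, j}\<close> is \<open>cyclic_interval i j - {i}\<close>. A suitable \<open>j\<close> exists if \<open>i\<close> is not a coloop.\<close>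
definition decorated_permutation :: "'n::{finite,linorder} set set \<Rightarrow> 'n \<Rightarrow> 'n" where
  "decorated_permutation \<B> i =
     (let P = (\<lambda>j. j \<noteq> i \<and> rk \<B> (cyclic_interval i j) = rk \<B> (cyclic_interval i j - {i}))
      in THE j. P j \<and> (\<forall>k. P k \<longrightarrow> cyclic_le i j k))"

definition ccw_arrow :: "('n::linorder \<Rightarrow> 'n) \<Rightarrow> 'n \<Rightarrow> 'n set" where
  "ccw_arrow \<pi> x = cyclic_interval x (inv \<pi> x)"

text \<open>This counts the \<open>x\<close>, not the distinct sets \<open>ccw_arrow \<pi> x\<close>; several arrows may equal
  all of \<open>[n]\<close>.\<close>
definition ccw :: "('n::linorder \<Rightarrow> 'n) \<Rightarrow> 'n set \<Rightarrow> nat" where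
  "ccw \<pi> S = card {x. ccw_arrow \<pi> x \<subseteq> S}"

definition ccw_covered :: "('n::linorder \<Rightarrow> 'n) \<Rightarrow> 'n set \<Rightarrow> bool" where
  "ccw_covered \<pi> S \<longleftrightarrow> (\<forall>s\<in>S. \<exists>x. s \<in> ccw_arrow \<pi> x \<and> ccw_arrow \<pi> x \<subseteq> S)"

end

(*
  Let r E = d - ccw(E^c). Telescoping ranks along a cyclic order that starts in E gives rk E <= r E
  for all nonempty E, with equality for cyclic intervals. As ccw counts the arrows inside a set, it
  is supermodular, so r is submodular on intersecting pairs. Uncrossing tight sets then shows that
  the vertices of {x >= 0, x(E) <= r E for all nonempty E} are 0/1 vectors, and that each of them
  extends to a feasible set J of size d. Such a J satisfies card (J Int I) <= rk I for all cyclic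
  intervals I, hence is a basis by Oh's theorem.

  For Oh's theorem let J be a d-set with card (J Int I) <= rk I for all cyclic intervals I, let C be
  a basis closest to J, and suppose there is an a in C - J. The fundamental cocircuit D of a with
  respect to C misses J. By a three-term Pluecker relation, fundamental circuits of C do not cross D,
  so C spans each arc between consecutive points of D. Summing over the arcs bounds card J by
  card (C - {a}).
*)
theory Submission
  imports Defs
begin

section \<open>Matroids\<close>

locale matroid =
  fixes \<B> :: "'a::finite set set"
  assumes bases: "matroid_bases \<B>"
begin

lemma exchange:
  assumes "B \<in> \<B>" "C \<in> \<B>" "b \<in> B" "b \<notin> C"
  obtains c where "c \<in> C" "c \<notin> B" "insert c (B - {b}) \<in> \<B>"
  using bases assms unfolding matroid_bases_def by (metis DiffE DiffI)

text \<open>Each exchange replaces an element outside \<open>C\<close> by one of \<open>C\<close>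
  and keeps the cardinality. The induction ends at \<open>B \<subseteq> C\<close>, where an element
  of \<open>C - B\<close> would have no exchange partner.\<close>

lemma card_basis_eq:
  assumes "B \<in> \<B>" "C \<in> \<B>"
  shows "card B = card C"
  using assms(1)
proof (induction "card (B - C)" arbitrary: B rule: less_induct)
  case less
  show ?case
  proof (cases "B \<subseteq> C")
    case True
    have "C \<subseteq> B"
      using exchange[OF assms(2) less.prems] True by blast
    then show ?thesis using True by simp
  next
    case False
    then obtain b where b: "b \<in> B" "b \<notin> C" by blast
    then obtain c where c: "c \<in> C" "c \<notin> B" "insert c (B - {b}) \<in> \<B>"
      using exchange less.prems assms(2) by metis
    have "insert c (B - {b}) - C \<subset> B - C" using b c by auto
    then have "card (insert c (B - {b})) = card C"
      using less.hyps[OF _ c(3)] by (simp add: psubset_card_mono)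
    moreover have "card (insert c (B - {b})) = card B"
      using b c by (metis Diff_iff card.remove card_insert_disjoint finite)
    ultimately show ?thesis by simp
  qed
qed

lemma indep_empty: "indep \<B> {}"
  using bases unfolding matroid_bases_def indep_def by auto

lemma indep_mono: "indep \<B> I \<Longrightarrow> J \<subseteq> I \<Longrightarrow> indep \<B> J"
  unfolding indep_def by blast

text \<open>The independence axiom, derived from basis exchange. Extend \<open>X\<close> to a basis
  \<open>B1\<close> and \<open>I\<close> to a basis \<open>B2\<close> with as few elements as
  possible outside \<open>I \<union> B1\<close>. If nothing in \<open>I\<close> augments
  \<open>X\<close>, then \<open>B2 - B1 = I - X\<close> and \<open>B1 - B2\<close> lies in
  \<open>X - I\<close>, so \<open>I\<close> cannot be larger than \<open>X\<close>.\<close>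

lemma augment:
  assumes "indep \<B> X" "indep \<B> I" "card X < card I"
  obtains f where "f \<in> I" "f \<notin> X" "indep \<B> (insert f X)"
proof (rule ccontr)
  assume "\<not> thesis"
  then have no: "\<And>f. f \<in> I \<Longrightarrow> f \<notin> X \<Longrightarrow> \<not> indep \<B> (insert f X)"
    using that by blast
  obtain B1 where B1: "B1 \<in> \<B>" "X \<subseteq> B1" using assms(1) indep_def by metis
  have "f \<notin> B1" if "f \<in> I" "f \<notin> X" for f
    using no[OF that] B1 unfolding indep_def by blast
  then have IB1: "I - B1 = I - X" using B1 by blast
  define P where "P = (\<lambda>B. B \<in> \<B> \<and> I \<subseteq> B)"
  obtain B0 where "P B0" using assms(2) unfolding indep_def P_def by blast
  then have "\<exists>B. P B \<and> (\<forall>C. P C \<longrightarrow> card (B - (I \<union> B1)) \<le> card (C - (I \<union> B1)))"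
    by (rule ex_has_least_nat)
  then obtain B2 where B2: "B2 \<in> \<B>" "I \<subseteq> B2"
    and min: "\<And>B. B \<in> \<B> \<Longrightarrow> I \<subseteq> B \<Longrightarrow> card (B2 - (I \<union> B1)) \<le> card (B - (I \<union> B1))"
    unfolding P_def by blast
  have 1: "B2 \<subseteq> I \<union> B1"
  proof (rule ccontr)
    assume "\<not> B2 \<subseteq> I \<union> B1"
    then obtain x where x: "x \<in> B2" "x \<notin> I" "x \<notin> B1" by blast
    obtain y where y: "y \<in> B1" "y \<notin> B2" "insert y (B2 - {x}) \<in> \<B>"
      by (rule exchange[OF B2(1) B1(1) x(1,3)])
    have "insert y (B2 - {x}) - (I \<union> B1) = B2 - (I \<union> B1) - {x}" using y(1) by blast
    moreover have "x \<in> B2 - (I \<union> B1)" using x by simp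
    ultimately have "card (insert y (B2 - {x}) - (I \<union> B1)) < card (B2 - (I \<union> B1))"
      by (metis card_Diff1_less finite)
    moreover have "I \<subseteq> insert y (B2 - {x})" using B2 x by blast
    ultimately show False using min[OF y(3)] by simp
  qed
  \<comment> \<open>An exchange out of \<open>B1\<close> that keeps \<open>X\<close> would bring in
    an element of \<open>I\<close> and thus augment \<open>X\<close>.\<close>
  have 2: "B1 \<subseteq> X \<union> B2"
  proof (rule ccontr)
    assume "\<not> B1 \<subseteq> X \<union> B2"
    then obtain x where x: "x \<in> B1" "x \<notin> X" "x \<notin> B2" by blast
    obtain y where y: "y \<in> B2" "y \<notin> B1" "insert y (B1 - {x}) \<in> \<B>"
      by (rule exchange[OF B1(1) B2(1) x(1,3)])
    have "y \<in> I" using 1 y by blast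
    moreover have "y \<notin> X" using B1 y by blast
    moreover have "insert y X \<subseteq> insert y (B1 - {x})" using B1 x by blast
    ultimately show False using no[of y] y(3) unfolding indep_def by blast
  qed
  have "card (B1 - B2) = card (B2 - B1)"
    using card_basis_eq[OF B1(1) B2(1)]
    by (simp add: card_Diff_subset_Int Int_commute)
  moreover have "B2 - B1 = I - X" using 1 IB1 B2 by blast
  moreover have "card (B1 - B2) \<le> card (X - I)"
    using 2 B2 by (intro card_mono) auto
  ultimately have "card (I - X) \<le> card (X - I)" by simp
  moreover have "card I = card (I \<inter> X) + card (I - X)" "card X = card (I \<inter> X) + card (X - I)"
    using card_Int_Diff[of I X] card_Int_Diff[of X I] by (simp_all add: Int_commute)
  ultimately show False using assms(3) by simp
qed

section \<open>The rank function\<close>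

lemma card_le_rk: "I \<subseteq> S \<Longrightarrow> indep \<B> I \<Longrightarrow> card I \<le> rk \<B> S"
  unfolding rk_def by (rule Max_ge) auto

lemma rk_attained: obtains I where "I \<subseteq> S" "indep \<B> I" "card I = rk \<B> S"
proof -
  have "rk \<B> S \<in> card ` {I. I \<subseteq> S \<and> indep \<B> I}"
    unfolding rk_def by (rule Max_in) (use indep_empty in auto)
  then show ?thesis using that by auto
qed

lemma rk_extend:
  assumes "I \<subseteq> S" "indep \<B> I"
  obtains J where "I \<subseteq> J" "J \<subseteq> S" "indep \<B> J" "card J = rk \<B> S"
proof -
  define P where "P = (\<lambda>J. I \<subseteq> J \<and> J \<subseteq> S \<and> indep \<B> J)"
  have "P I" using assms unfolding P_def by simp
  moreover have "\<forall>K. P K \<longrightarrow> card K < Suc (card S)"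
    by (simp add: P_def card_mono less_Suc_eq_le)
  ultimately have "\<exists>J. P J \<and> (\<forall>K. P K \<longrightarrow> card K \<le> card J)"
    by (rule ex_has_greatest_nat)
  then obtain J where J: "P J" and max: "\<And>K. P K \<Longrightarrow> card K \<le> card J" by blast
  obtain K where K: "K \<subseteq> S" "indep \<B> K" "card K = rk \<B> S" by (rule rk_attained)
  have "card J = rk \<B> S"
  proof (rule ccontr)
    assume "card J \<noteq> rk \<B> S"
    then have "card J < card K" using J K card_le_rk[of J S] unfolding P_def by simp
    then obtain f where "f \<in> K" "f \<notin> J" "indep \<B> (insert f J)"
      using augment J K unfolding P_def by metis
    then have "P (insert f J)" using J K unfolding P_def by blast
    then show False using max \<open>f \<notin> J\<close> by fastforce
  qed
  then show ?thesis using that J unfolding P_def by blast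
qed

lemma rk_mono: "S \<subseteq> T \<Longrightarrow> rk \<B> S \<le> rk \<B> T"
  by (metis card_le_rk order_trans rk_attained)

lemma rk_le_card: "rk \<B> S \<le> card S"
  by (metis card_mono finite rk_attained)

lemma rk_empty [simp]: "rk \<B> {} = 0"
  using rk_le_card[of "{}"] by simp

lemma rk_insert_le: "rk \<B> (insert x S) \<le> Suc (rk \<B> S)"
proof -
  obtain I where I: "I \<subseteq> insert x S" "indep \<B> I" "card I = rk \<B> (insert x S)"
    by (rule rk_attained)
  then have "card (I - {x}) \<le> rk \<B> S"
    by (intro card_le_rk) (auto intro: indep_mono)
  moreover have "card I \<le> Suc (card (I - {x}))" by (metis card_Diff1_le card_Suc_Diff1 finite Diff_empty Diff_insert0 le_SucI order_refl)
  ultimately show ?thesis using I(3) by simp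
qed

text \<open>Monotonicity of the closure, the form of submodularity on which the arrow arguments
  rest. A maximal independent \<open>I0\<close> in \<open>X\<close> extends to one in
  \<open>insert x Y\<close>; if this exceeded the rank of \<open>Y\<close> it would contain
  \<open>x\<close>, and \<open>insert x I0\<close> would be too large for
  \<open>insert x X\<close>.\<close>

lemma rk_insert_eq_mono:
  assumes "X \<subseteq> Y" "rk \<B> (insert x X) = rk \<B> X"
  shows "rk \<B> (insert x Y) = rk \<B> Y"
proof (rule ccontr)
  assume ne: "rk \<B> (insert x Y) \<noteq> rk \<B> Y"
  then have less: "rk \<B> Y < rk \<B> (insert x Y)"
    using rk_mono[of Y "insert x Y"] by (simp add: subset_insertI)
  have xY: "x \<notin> Y" using ne by (auto simp: insert_absorb)
  obtain I0 where I0: "I0 \<subseteq> X" "indep \<B> I0" "card I0 = rk \<B> X" by (rule rk_attained)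
  obtain I1 where I1: "I0 \<subseteq> I1" "I1 \<subseteq> insert x Y" "indep \<B> I1" "card I1 = rk \<B> (insert x Y)"
    using rk_extend[of I0 "insert x Y"] I0 assms(1) by blast
  have "x \<in> I1" using I1 less card_le_rk[of I1 Y] by (metis not_le subset_insert)
  then have "indep \<B> (insert x I0)" using I1 by (auto intro: indep_mono)
  then have "card (insert x I0) \<le> rk \<B> (insert x X)" using I0 by (intro card_le_rk) auto
  moreover have "x \<notin> I0" using xY I0 assms(1) by blast
  ultimately show False using I0 assms(2) by simp
qed

lemma rk_UNIV:
  assumes "B \<in> \<B>"
  shows "rk \<B> UNIV = card B"
proof (rule antisym)
  obtain I where "indep \<B> I" "card I = rk \<B> UNIV" by (rule rk_attained)
  then obtain C where "C \<in> \<B>" "I \<subseteq> C" unfolding indep_def by blast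
  then show "rk \<B> UNIV \<le> card B"
    using \<open>card I = _\<close> card_basis_eq[OF \<open>C \<in> \<B>\<close> assms] by (metis card_mono finite)
  show "card B \<le> rk \<B> UNIV" by (rule card_le_rk) (use assms in \<open>auto simp: indep_def\<close>)
qed

text \<open>Were the rank of \<open>J\<close> larger, some \<open>f\<close> in \<open>J - B\<close>
  would augment \<open>B \<inter> J\<close>. Extending inside \<open>insert f B\<close> gives a
  basis that omits just one element \<open>c\<close> of \<open>B\<close>, necessarily outside
  \<open>J\<close>, which is an excluded exchange.\<close>

lemma rk_Int_basis:
  assumes "B \<in> \<B>"
    and stay: "\<And>f c. f \<in> J - B \<Longrightarrow> c \<in> B - J \<Longrightarrow> insert f (B - {c}) \<notin> \<B>"
  shows "rk \<B> J = card (B \<inter> J)"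
proof (rule ccontr)
  have indB: "indep \<B> (B \<inter> J)" using assms(1) unfolding indep_def by blast
  assume "rk \<B> J \<noteq> card (B \<inter> J)"
  then have less: "card (B \<inter> J) < rk \<B> J" using card_le_rk[OF _ indB, of J] by simp
  obtain I where I: "I \<subseteq> J" "indep \<B> I" "card I = rk \<B> J" by (rule rk_attained)
  obtain f where f: "f \<in> I" "f \<notin> B \<inter> J" "indep \<B> (insert f (B \<inter> J))"
    using augment[OF indB I(2)] less I(3) by metis
  have fJ: "f \<in> J" "f \<notin> B" using f I by auto
  obtain K where K: "insert f (B \<inter> J) \<subseteq> K" "K \<subseteq> insert f B" "indep \<B> K" "card K = rk \<B> (insert f B)"
    using rk_extend[OF _ f(3), of "insert f B"] by blast
  have "card B \<le> rk \<B> (insert f B)" using assms(1) by (intro card_le_rk) (auto simp: indep_def)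
  moreover obtain C where C: "C \<in> \<B>" "K \<subseteq> C" using K(3) unfolding indep_def by blast
  ultimately have "K = C"
    using K(4) card_basis_eq[OF assms(1) C(1)] by (metis card_seteq finite)
  then have KB: "K \<in> \<B>" using C by simp
  have cK: "card K = card B" using card_basis_eq[OF KB assms(1)] .
  have "\<not> B \<subseteq> K" using cK K fJ by (metis card_subset_eq finite insert_subset)
  then obtain c where c: "c \<in> B" "c \<notin> K" by blast
  have "K \<subseteq> insert f (B - {c})" using K c by blast
  moreover have "card (insert f (B - {c})) = card B"
    using c fJ by (metis Diff_iff card.remove card_insert_disjoint finite)
  ultimately have "K = insert f (B - {c})" using cK by (metis card_subset_eq finite)
  moreover have "c \<in> B - J" using c K by blast
  ultimately show False using stay KB fJ by blast
qed

end

section \<open>Signs of maximal minors and the noncrossing property\<close>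

text \<open>The value on equal arguments is -1, so that the square is 1 without a case
  distinction.\<close>

definition order_sign :: "'a::linorder \<Rightarrow> 'a \<Rightarrow> real" where
  "order_sign u v = (if u < v then 1 else - 1)"

lemma order_sign_square [simp]: "order_sign u v * order_sign u v = 1"
  by (simp add: order_sign_def)

lemma order_sign_swap: "u \<noteq> v \<Longrightarrow> order_sign v u = - order_sign u v"
  by (auto simp: order_sign_def)

text \<open>For injective \<open>g\<close> this is the sign of the permutation that sorts
  \<open>g\<close>. The product over pairs makes maps that differ in few values easy to
  compare.\<close>

definition sorting_sign :: "('d::{finite,linorder} \<Rightarrow> 'n::linorder) \<Rightarrow> real" where
  "sorting_sign g = (\<Prod>(x, y)\<in>{(x, y). x < y}. order_sign (g x) (g y))"

lemma adjacent_transpose_less: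
  fixes r s x y :: "'d::linorder"
  assumes "r < s" and adj: "\<And>z. \<not> (r < z \<and> z < s)" and "x < y" "(x, y) \<noteq> (r, s)"
  shows "Transposition.transpose r s x < Transposition.transpose r s y"
  using assms(1,3,4) adj[of x] adj[of y] by (auto simp: Transposition.transpose_def)

text \<open>Reindexes products over pairs: a swap of adjacent positions reverses only the pair
  \<open>(r, s)\<close> and permutes the others.\<close>

lemma adjacent_transpose_pairs:
  fixes r s :: "'d::linorder"
  assumes "r < s" "\<And>z. \<not> (r < z \<and> z < s)"
  shows "bij_betw (map_prod (Transposition.transpose r s) (Transposition.transpose r s))
    ({(x, y). x < y} - {(r, s)}) ({(x, y). x < y} - {(r, s)})"
    (is "bij_betw ?F ?Q ?Q")
proof (rule bij_betw_byWitness[where f' = ?F])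
  have "(Transposition.transpose r s x, Transposition.transpose r s y) \<noteq> (r, s)" if "x < y" for x y
    using that assms(1) by (auto simp: Transposition.transpose_def)
  then show "?F ` ?Q \<subseteq> ?Q" "?F ` ?Q \<subseteq> ?Q"
    using adjacent_transpose_less[OF assms] by auto
qed auto

lemma sorting_sign_transpose:
  fixes g :: "'d::{finite,linorder} \<Rightarrow> 'n::linorder"
  assumes "inj g" "r < s" "\<And>z. \<not> (r < z \<and> z < s)"
  shows "sorting_sign (g \<circ> Transposition.transpose r s) = - sorting_sign g"
proof -
  let ?t = "Transposition.transpose r s"
  let ?P = "{(x, y). x < y} :: ('d \<times> 'd) set"
  have split: "sorting_sign h = order_sign (h r) (h s) * (\<Prod>(x, y)\<in>?P - {(r, s)}. order_sign (h x) (h y))"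
    for h :: "'d \<Rightarrow> 'n"
    unfolding sorting_sign_def using assms(2) by (subst prod.remove[of _ "(r, s)"]) auto
  have "(\<Prod>(x, y)\<in>?P - {(r, s)}. order_sign ((g \<circ> ?t) x) ((g \<circ> ?t) y)) =
      (\<Prod>(x, y)\<in>?P - {(r, s)}. order_sign (g x) (g y))"
    using prod.reindex_bij_betw[OF adjacent_transpose_pairs[OF assms(2,3)],
        of "\<lambda>(x, y). order_sign (g x) (g y)"]
    by (simp add: case_prod_beta map_prod_def)
  moreover have "g r \<noteq> g s" using assms(1,2) by (metis injD less_irrefl)
  ultimately show ?thesis
    unfolding split by (simp add: order_sign_swap[of "g r"])
qed

lemma maximal_minor_transpose:
  assumes "r \<noteq> s"
  shows "maximal_minor A (g \<circ> Transposition.transpose r s) = - maximal_minor A g"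
  using det_permute_columns[of "Transposition.transpose r s" "\<chi> i j. A $ i $ g j"] assms
  by (simp add: maximal_minor_def permutes_swap_id sign_swap_id)

text \<open>Take an inversion with the fewest positions in between; any such position would form a
  shorter inversion with one of the two ends.\<close>

lemma obtain_adjacent_inversion:
  fixes g :: "'d::{finite,linorder} \<Rightarrow> 'n::linorder"
  assumes "inj g" "\<not> strict_mono g"
  obtains r s where "r < s" "g s < g r" "\<And>z. \<not> (r < z \<and> z < s)"
proof -
  define P where "P = (\<lambda>(x, y). x < y \<and> g y < g x)"
  obtain x y where "x < y" "\<not> g x < g y" using assms(2) unfolding strict_mono_def by blast
  moreover have "g x \<noteq> g y" using \<open>x < y\<close> assms(1) by (metis injD less_irrefl)
  ultimately have "P (x, y)" unfolding P_def by (simp add: neq_iff)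
  then have "\<exists>p. P p \<and> (\<forall>q. P q \<longrightarrow> card {fst p<..<snd p} \<le> card {fst q<..<snd q})"
    by (rule ex_has_least_nat)
  then obtain r s where rs: "P (r, s)"
    and min: "\<And>x y. P (x, y) \<Longrightarrow> card {r<..<s} \<le> card {x<..<y}"
    by fastforce
  have "\<not> (r < z \<and> z < s)" for z
  proof
    assume z: "r < z \<and> z < s"
    have "{r<..<z} \<subset> {r<..<s}" "{z<..<s} \<subset> {r<..<s}" using z by auto
    then have "card {r<..<z} < card {r<..<s}" "card {z<..<s} < card {r<..<s}"
      by (auto intro: psubset_card_mono)
    then have "\<not> P (r, z)" "\<not> P (z, s)" using min by (meson not_le)+
    then show False using z rs unfolding P_def by auto
  qed
  then show ?thesis using that rs unfolding P_def by blast
qed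

text \<open>Bubble sort: a swap at an adjacent inversion negates both the minor and the sorting
  sign, and it lowers the number of inversions.\<close>

lemma maximal_minor_sorted:
  fixes g :: "'d::{finite,linorder} \<Rightarrow> 'n::{finite,linorder}"
  assumes "inj g"
  obtains h where "strict_mono h" "range h = range g" "maximal_minor A h = sorting_sign g * maximal_minor A g"
  using assms
proof (induction "card {(x, y). x < y \<and> g y < g x}" arbitrary: g thesis rule: less_induct)
  case less
  show ?case
  proof (cases "strict_mono g")
    case True
    then have "sorting_sign g = 1"
      unfolding sorting_sign_def by (intro prod.neutral) (auto simp: order_sign_def strict_mono_def)
    then show ?thesis using less.prems(1)[of g] True by simp
  next
    case False
    obtain r s where rs: "r < s" "g s < g r" "\<And>z. \<not> (r < z \<and> z < s)"
      using obtain_adjacent_inversion[OF less.prems(2) False] by metis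
    let ?t = "Transposition.transpose r s"
    have inj: "inj (g \<circ> ?t)" using less.prems(2) by (simp add: inj_compose)
    let ?I = "{(x, y). x < y \<and> (g \<circ> ?t) y < (g \<circ> ?t) x}" and ?J = "{(x, y). x < y \<and> g y < g x}"
    have "(r, s) \<notin> ?I" using rs by auto
    have "map_prod ?t ?t ` ?I \<subseteq> ?J - {(r, s)}"
    proof
      fix p assume "p \<in> map_prod ?t ?t ` ?I"
      then obtain x y where xy: "p = (?t x, ?t y)" "(x, y) \<in> ?I" by auto
      have m: "(x, y) \<in> {(x, y). x < y} - {(r, s)}" using xy(2) \<open>(r, s) \<notin> ?I\<close> by blast
      have "map_prod ?t ?t (x, y) \<in> {(x, y). x < y} - {(r, s)}"
        by (rule bspec[OF bij_betwE[OF adjacent_transpose_pairs[OF rs(1,3)]] m])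
      then show "p \<in> ?J - {(r, s)}" using xy by simp
    qed
    moreover have "inj_on (map_prod ?t ?t) ?I"
      by (rule inj_on_subset[OF prod.inj_map]) auto
    ultimately have "card ?I \<le> card (?J - {(r, s)})"
      by (intro card_inj_on_le[of "map_prod ?t ?t"]) auto
    also have "\<dots> < card ?J" using rs by (intro psubset_card_mono) auto
    finally obtain h where h: "strict_mono h" "range h = range (g \<circ> ?t)"
        "maximal_minor A h = sorting_sign (g \<circ> ?t) * maximal_minor A (g \<circ> ?t)"
      using less.hyps[OF _ _ inj] by metis
    have "range (g \<circ> ?t) = range g"
      by (metis fun.set_map surj_transpose)
    then show ?thesis
      using less.prems(1)[of h] h sorting_sign_transpose[OF less.prems(2) rs(1,3)]
        maximal_minor_transpose[of r s A g] rs(1) by simp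
  qed
qed

text \<open>The value at \<open>x\<close> is the element of the range with exactly as many smaller
  elements in the range as \<open>x\<close> has predecessors.\<close>

lemma strict_mono_range_unique:
  fixes h k :: "'d::{finite,linorder} \<Rightarrow> 'n::linorder"
  assumes "strict_mono h" "strict_mono k" "range h = range k"
  shows "h = k"
proof
  fix x
  have rank: "card {y \<in> range f. y < f x} = card {z. z < x}" if "strict_mono f" for f :: "'d \<Rightarrow> 'n"
  proof -
    have "{y \<in> range f. y < f x} = f ` {z. z < x}"
      using that by (auto simp: strict_mono_less)
    then show ?thesis using that by (metis card_image inj_on_subset strict_mono_imp_inj_on subset_UNIV)
  qed
  have less: False if "u < v" "u \<in> range h" "card {y \<in> range h. y < u} = card {y \<in> range h. y < v}" for u v
  proof -
    have "{y \<in> range h. y < u} \<subset> {y \<in> range h. y < v}" using that by auto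
    then have "card {y \<in> range h. y < u} < card {y \<in> range h. y < v}"
      by (intro psubset_card_mono) auto
    then show False using that(3) by simp
  qed
  have "card {y \<in> range h. y < h x} = card {y \<in> range h. y < k x}"
    using rank[OF assms(1)] rank[OF assms(2)] assms(3) by simp
  then show "h x = k x"
    using less[of "h x" "k x"] less[of "k x" "h x"] assms(3) by (metis linorder_neqE rangeI)
qed

text \<open>For a pair of positions other than \<open>r\<close> and \<open>s\<close> together, every
  sign occurs an even number of times among the four maps and cancels.\<close>

lemma sorting_sign_two_updates:
  fixes g :: "'d::{finite,linorder} \<Rightarrow> 'n::linorder"
  assumes "inj g" "r \<noteq> s" "e \<noteq> f" "e \<notin> range g" "f \<notin> range g"
  shows "sorting_sign g * sorting_sign (g(r := e, s := f)) * sorting_sign (g(r := e)) * sorting_sign (g(s := f)) =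
    order_sign (g r) (g s) * order_sign e f * order_sign e (g s) * order_sign (g r) f"
    (is "?L = ?R")
proof -
  let ?P = "{(x, y). x < y} :: ('d \<times> 'd) set"
  let ?h = "\<lambda>(x, y). order_sign (g x) (g y) *
    order_sign ((g(r := e, s := f)) x) ((g(r := e, s := f)) y) *
    order_sign ((g(r := e)) x) ((g(r := e)) y) * order_sign ((g(s := f)) x) ((g(s := f)) y)"
  have sq: "a * b * a * b = 1" "a * b * b * a = 1" "a * a * b * b = 1" if "a * a = 1" "b * b = 1" for a b :: real
  proof -
    have "a * a * (b * b) = 1" using that by simp
    then show "a * b * a * b = 1" "a * b * b * a = 1" "a * a * b * b = 1" by (simp_all only: mult_ac)
  qed
  have "?L = (\<Prod>p\<in>?P. ?h p)"
    unfolding sorting_sign_def prod.distrib[symmetric] by (rule prod.cong) auto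
  also have "\<dots> = (\<Prod>p\<in>?P \<inter> {(r, s), (s, r)}. ?h p)"
  proof (rule prod.mono_neutral_right)
    show "\<forall>p\<in>?P - ?P \<inter> {(r, s), (s, r)}. ?h p = 1"
    proof
      fix p assume p: "p \<in> ?P - ?P \<inter> {(r, s), (s, r)}"
      obtain x y where xy: "p = (x, y)" by (cases p)
      consider "x = r" "y \<noteq> r" "y \<noteq> s" | "x = s" "y \<noteq> r" "y \<noteq> s" | "y = r" "x \<noteq> r" "x \<noteq> s"
        | "y = s" "x \<noteq> r" "x \<noteq> s" | "x \<noteq> r" "x \<noteq> s" "y \<noteq> r" "y \<noteq> s"
        using p xy by auto
      then show "?h p = 1"
        unfolding xy using assms(2) by cases (simp_all add: sq)
    qed
  qed auto
  also have "?P \<inter> {(r, s), (s, r)} = (if r < s then {(r, s)} else {(s, r)})"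
    using assms(2) by auto
  also have "(\<Prod>p\<in>\<dots>. ?h p) = ?R"
  proof (cases "r < s")
    \<comment> \<open>In the other order of the positions all four factors change sign, so the
      product stays the same.\<close>
    case False
    have "g r \<noteq> g s" "e \<noteq> g s" "f \<noteq> g r" using assms by (auto dest: injD)
    then have "order_sign (g s) (g r) = - order_sign (g r) (g s)"
        "order_sign (g s) e = - order_sign e (g s)" "order_sign f (g r) = - order_sign (g r) f"
        "order_sign f e = - order_sign e f"
      using assms(3) by (auto intro: order_sign_swap)
    then show ?thesis using False assms(2) by simp
  qed (use assms(2) in auto)
  finally show ?thesis .
qed

text \<open>Let \<open>x\<close> hold the coefficients of column \<open>f\<close> in the columns
  chosen by \<open>g\<close>. By Cramer's rule, putting \<open>f\<close> at a position multiplies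
  the minor by the coefficient there. The one at \<open>r\<close> vanishes, so the expansion of
  \<open>f\<close> survives replacing column \<open>r\<close> by \<open>e\<close>, and both sides
  contain the coefficient at \<open>s\<close>.\<close>

lemma maximal_minor_two_updates:
  fixes A :: "real ^ 'n::finite ^ 'd::finite"
  assumes "r \<noteq> s" "maximal_minor A g \<noteq> 0" "maximal_minor A (g(r := f)) = 0"
  shows "maximal_minor A (g(r := e, s := f)) * maximal_minor A g =
    maximal_minor A (g(r := e)) * maximal_minor A (g(s := f))"
proof -
  let ?M = "\<lambda>g. \<chi> i j. A $ i $ g j"
  obtain N where "?M g ** N = mat 1"
    using assms(2) unfolding maximal_minor_def invertible_det_nz[symmetric] invertible_def by blast
  define x where "x = N *v column f A"
  have "?M g *v x = column f A"
    by (simp add: x_def matrix_vector_mul_assoc \<open>?M g ** N = mat 1\<close>)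
  then have x: "(\<Sum>j\<in>UNIV. A $ i $ g j * x $ j) = A $ i $ f" for i
    by (simp add: matrix_vector_mult_def vec_eq_iff column_def)
  have upd: "maximal_minor A (h(k := f)) = x $ k * maximal_minor A h"
    if "\<And>i. (\<Sum>j\<in>UNIV. A $ i $ h j * x $ j) = A $ i $ f" for h k
  proof -
    have "(?M (h(k := f))) = (\<chi> i j. if j = k then (?M h *v x) $ i else ?M h $ i $ j)"
      by (simp add: vec_eq_iff matrix_vector_mult_def that)
    then show ?thesis unfolding maximal_minor_def using cramer_lemma[of k "?M h" x] by simp
  qed
  have "x $ r = 0" using upd[OF x, of r] assms(2,3) by simp
  then have "(\<Sum>j\<in>UNIV. A $ i $ (g(r := e)) j * x $ j) = A $ i $ f" for i
    unfolding x[of i, symmetric] by (intro sum.cong) auto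
  then have "maximal_minor A (g(r := e, s := f)) = x $ s * maximal_minor A (g(r := e))"
    by (rule upd)
  then show ?thesis using upd[OF x, of s] by simp
qed

lemma positroid_card:
  assumes "positroid TYPE('d::{finite,linorder}) \<B>" "B \<in> \<B>"
  shows "card B = CARD('d)"
  using assms unfolding positroid_def
  by (auto simp: card_image strict_mono_imp_inj_on)

text \<open>The three-term Pluecker relation, in the case where one of its three products vanishes:
  the remaining two have the same absolute value, and their signs would differ if the chord from
  \<open>a\<close> to \<open>e\<close> crossed the chord from \<open>c\<close> to \<open>f\<close>.\<close>
lemma positroid_noncrossing:
  fixes \<B> :: "'n::{finite,linorder} set set"
  assumes "positroid TYPE('d::{finite,linorder}) \<B>" "B \<in> \<B>"
    and "a \<in> B" "c \<in> B" "a \<noteq> c" "e \<notin> B" "f \<notin> B" "e \<noteq> f"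
    and "insert e (B - {a}) \<in> \<B>" "insert f (B - {c}) \<in> \<B>" "insert f (B - {a}) \<notin> \<B>"
  shows "(a < c \<longleftrightarrow> c < e) \<longleftrightarrow> (a < f \<longleftrightarrow> f < e)"
proof -
  from assms(1) obtain A :: "((real, 'n) vec, 'd) vec" where
    pos: "\<And>f. strict_mono f \<Longrightarrow> maximal_minor A f \<ge> 0" and
    \<B>: "\<B> = {range f | f. strict_mono f \<and> maximal_minor A f \<noteq> 0}"
    unfolding positroid_def by blast
  \<comment> \<open>Carries nonnegativity and the description of the bases over from increasing to
    arbitrary injective enumerations, since the updates of \<open>g\<close> need not be
    increasing.\<close>
  have sgn: "sorting_sign g * maximal_minor A g \<ge> 0"
    and mem: "range g \<in> \<B> \<longleftrightarrow> maximal_minor A g \<noteq> 0" if g: "inj g" for g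
  proof -
    obtain h where h: "strict_mono h" "range h = range g"
      "maximal_minor A h = sorting_sign g * maximal_minor A g"
      using maximal_minor_sorted[OF g] by blast
    show "sorting_sign g * maximal_minor A g \<ge> 0" using pos[OF h(1)] h(3) by simp
    have "sorting_sign g \<noteq> 0" unfolding sorting_sign_def by (auto simp: order_sign_def)
    then have "maximal_minor A h \<noteq> 0 \<longleftrightarrow> maximal_minor A g \<noteq> 0" using h(3) by simp
    moreover have "range g \<in> \<B> \<longleftrightarrow> maximal_minor A h \<noteq> 0"
    proof
      assume "range g \<in> \<B>"
      then obtain k where k: "strict_mono k" "range g = range k" "maximal_minor A k \<noteq> 0"
        unfolding \<B> by blast
      then show "maximal_minor A h \<noteq> 0" using strict_mono_range_unique[OF h(1) k(1)] h(2) by simp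
    next
      assume "maximal_minor A h \<noteq> 0"
      then have "range h \<in> \<B>" using h(1) unfolding \<B> by blast
      then show "range g \<in> \<B>" using h(2) by simp
    qed
    ultimately show "range g \<in> \<B> \<longleftrightarrow> maximal_minor A g \<noteq> 0" by simp
  qed
  obtain g :: "'d \<Rightarrow> 'n" where g: "strict_mono g" "range g = B" "maximal_minor A g \<noteq> 0"
    using assms(2) unfolding \<B> by blast
  have inj: "inj g" using g(1) by (rule strict_mono_imp_inj_on)
  obtain r s where rs: "g r = a" "g s = c" using assms(3,4) g(2) by blast
  then have "r \<noteq> s" using assms(5) by blast
  have upd: "inj (g(k := z))" "range (g(k := z)) = insert z (B - {g k})" if "z \<notin> B" for k z
  proof -
    show "inj (g(k := z))" using inj that g(2) by (intro inj_on_fun_updI) auto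
    show "range (g(k := z)) = insert z (B - {g k})"
      unfolding fun_upd_image g(2)[symmetric] using inj by (simp add: image_set_diff)
  qed
  have e: "maximal_minor A (g(r := e)) \<noteq> 0" and f: "maximal_minor A (g(s := f)) \<noteq> 0"
    and af: "maximal_minor A (g(r := f)) = 0"
    using assms(9-11) mem[OF upd(1)[OF assms(6)], of r] mem[OF upd(1)[OF assms(7)], of r]
      mem[OF upd(1)[OF assms(7)], of s] upd(2)[OF assms(6), of r] upd(2)[OF assms(7), of r]
      upd(2)[OF assms(7), of s] rs by simp_all
  have prod: "maximal_minor A (g(r := e, s := f)) * maximal_minor A g =
    maximal_minor A (g(r := e)) * maximal_minor A (g(s := f))"
    by (rule maximal_minor_two_updates[OF \<open>r \<noteq> s\<close> g(3) af])
  have "f \<notin> range (g(r := e))" unfolding upd(2)[OF assms(6)] using assms(7,8) by simp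
  then have inj2: "inj (g(r := e, s := f))"
    by (rule inj_on_fun_updI[OF upd(1)[OF assms(6)]])
  \<comment> \<open>By the relation \<open>prod\<close> the four minors multiply to a nonzero
    square, so the product of the four sorting signs is nonnegative.\<close>
  have "0 \<le> (sorting_sign g * maximal_minor A g) *
      (sorting_sign (g(r := e, s := f)) * maximal_minor A (g(r := e, s := f))) *
      (sorting_sign (g(r := e)) * maximal_minor A (g(r := e))) *
      (sorting_sign (g(s := f)) * maximal_minor A (g(s := f)))"
    by (rule mult_nonneg_nonneg[OF mult_nonneg_nonneg[OF mult_nonneg_nonneg]])
      (rule sgn[OF inj] sgn[OF inj2] sgn[OF upd(1)[OF assms(6)]] sgn[OF upd(1)[OF assms(7)]])+
  also have "\<dots> = (sorting_sign g * sorting_sign (g(r := e, s := f)) * sorting_sign (g(r := e)) * sorting_sign (g(s := f)))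
      * (maximal_minor A (g(r := e)) * maximal_minor A (g(s := f)))\<^sup>2"
    unfolding power2_eq_square by (subst (2) prod[symmetric]) (simp add: mult_ac)
  also have "\<dots> = (order_sign a c * order_sign e f * order_sign e c * order_sign a f)
      * (maximal_minor A (g(r := e)) * maximal_minor A (g(s := f)))\<^sup>2"
    using sorting_sign_two_updates[OF inj \<open>r \<noteq> s\<close> assms(8)] g(2) assms(6,7) rs by simp
  finally have "0 \<le> order_sign a c * order_sign e f * order_sign e c * order_sign a f"
    using e f by (simp add: zero_le_mult_iff)
  moreover have "c \<noteq> e" "a \<noteq> f" using assms by auto
  ultimately show ?thesis
    using assms(5,8) unfolding order_sign_def by (auto split: if_splits)
qed

section \<open>Cyclic intervals determine a positroid\<close>

lemma cyclic_le_refl [simp]: "cyclic_le a x x"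
  and cyclic_le_base [simp]: "cyclic_le a a x"
  by (auto simp: cyclic_le_def)

lemma cyclic_le_antisym: "cyclic_le a x y \<Longrightarrow> cyclic_le a y x \<Longrightarrow> x = y"
  and cyclic_le_trans: "cyclic_le a x y \<Longrightarrow> cyclic_le a y z \<Longrightarrow> cyclic_le a x z"
  and cyclic_le_linear: "cyclic_le a x y \<or> cyclic_le a y x"
  by (auto simp: cyclic_le_def)

lemma cyclic_least:
  assumes "finite S" "S \<noteq> {}"
  obtains p where "p \<in> S" "\<And>x. x \<in> S \<Longrightarrow> cyclic_le a p x"
proof -
  have "\<exists>p\<in>S. \<forall>x\<in>S. cyclic_le a p x"
    using assms
  proof (induction rule: finite_ne_induct)
    case (insert y S)
    then obtain p where "p \<in> S" "\<forall>x\<in>S. cyclic_le a p x" by blast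
    then show ?case
      using cyclic_le_linear[of a p y] cyclic_le_trans[of a y p] by (metis cyclic_le_refl insert_iff)
  qed simp
  then show ?thesis using that by blast
qed

lemma cyclic_greatest:
  assumes "finite S" "S \<noteq> {}"
  obtains p where "p \<in> S" "\<And>x. x \<in> S \<Longrightarrow> cyclic_le a x p"
proof -
  have "\<exists>p\<in>S. \<forall>x\<in>S. cyclic_le a x p"
    using assms
  proof (induction rule: finite_ne_induct)
    case (insert y S)
    then obtain p where "p \<in> S" "\<forall>x\<in>S. cyclic_le a x p" by blast
    then show ?case
      using cyclic_le_linear[of a p y] cyclic_le_trans[of a _ p y] by (metis cyclic_le_refl insert_iff)
  qed simp
  then show ?thesis using that by blast
qed

lemma cyclic_interval_eq:
  assumes "cyclic_le a p q"
  shows "cyclic_interval p q = {x. cyclic_le a p x \<and> cyclic_le a x q}"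
proof -
  have "cyclic_le p x q \<longleftrightarrow> cyclic_le a p x \<and> cyclic_le a x q" for x
    using assms unfolding cyclic_le_def by auto
  then show ?thesis by (simp add: cyclic_interval_def)
qed

lemma convex_imp_cyclic_interval:
  assumes "finite J" "J \<noteq> {}"
    and "\<And>x y z. x \<in> J \<Longrightarrow> z \<in> J \<Longrightarrow> cyclic_le a x y \<Longrightarrow> cyclic_le a y z \<Longrightarrow> y \<in> J"
  obtains p q where "J = cyclic_interval p q"
proof -
  obtain p where p: "p \<in> J" "\<And>x. x \<in> J \<Longrightarrow> cyclic_le a p x" using cyclic_least[OF assms(1,2), of a] by blast
  obtain q where q: "q \<in> J" "\<And>x. x \<in> J \<Longrightarrow> cyclic_le a x q" using cyclic_greatest[OF assms(1,2), of a] by blast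
  have "J = cyclic_interval p q"
    unfolding cyclic_interval_eq[OF p(2)[OF q(1)]] using p q assms(3) by blast
  then show ?thesis by (rule that)
qed

text \<open>Translates separation of \<open>x\<close> and \<open>y\<close> by the chord from
  \<open>a\<close> to \<open>e\<close> into the test used in
  \<open>positroid_noncrossing\<close>.\<close>

lemma crossing_separates:
  assumes "cyclic_le a e x \<noteq> cyclic_le a e y" "distinct [a, e, x, y]"
  shows "(a < x \<longleftrightarrow> x < e) \<noteq> (a < y \<longleftrightarrow> y < e)"
  using assms unfolding cyclic_le_def by auto

lemma card_Int_Union_disjoint:
  fixes B :: "'a::finite set"
  assumes "disjoint C"
  shows "card (B \<inter> \<Union>C) = (\<Sum>J\<in>C. card (B \<inter> J))"
proof -
  have "card (\<Union>J\<in>C. B \<inter> J) = (\<Sum>J\<in>C. card (B \<inter> J))"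
    by (rule card_UN_disjoint) (use assms in \<open>auto simp: disjoint_def\<close>)
  then show ?thesis by (simp only: Int_Union)
qed

text \<open>The arcs into which the points of \<open>D\<close> cut the circle, given a point \<open>a\<close> of \<open>D\<close>.\<close>
definition cut_arc :: "'n::linorder \<Rightarrow> 'n set \<Rightarrow> 'n \<Rightarrow> 'n set" where
  "cut_arc a D y = {x. x \<notin> D \<and> (\<forall>e\<in>D. cyclic_le a e x \<longleftrightarrow> cyclic_le a e y)}"

text \<open>The arc is convex in the order from \<open>a\<close>: a point between two of its members
  is preceded by the same points of \<open>D\<close>, and it is not itself in \<open>D\<close>, as
  it would then separate the two.\<close>

lemma cut_arc_is_cyclic_interval:
  fixes y :: "'n::{finite,linorder}"
  assumes "y \<notin> D"
  obtains p q where "cut_arc a D y = cyclic_interval p q"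
proof (rule convex_imp_cyclic_interval[where J = "cut_arc a D y" and a = a])
  show "cut_arc a D y \<noteq> {}" using assms unfolding cut_arc_def by blast
  show "u \<in> cut_arc a D y" if "x \<in> cut_arc a D y" "z \<in> cut_arc a D y" "cyclic_le a x u" "cyclic_le a u z" for x u z
  proof -
    have eq: "cyclic_le a e x \<longleftrightarrow> cyclic_le a e z" "cyclic_le a e x \<longleftrightarrow> cyclic_le a e y" if "e \<in> D" for e
      using that \<open>x \<in> _\<close> \<open>z \<in> _\<close> unfolding cut_arc_def by auto
    have "u \<notin> D"
      using eq(1)[of u] that cyclic_le_antisym[of a u x] unfolding cut_arc_def by blast
    moreover have "cyclic_le a e u \<longleftrightarrow> cyclic_le a e y" if "e \<in> D" for e
      using eq[OF that] cyclic_le_trans[of a e] \<open>cyclic_le a x u\<close> \<open>cyclic_le a u z\<close> by blast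
    ultimately show ?thesis unfolding cut_arc_def by blast
  qed
qed (auto intro: that)

text \<open>Oh's theorem: a positroid is determined by the ranks of the cyclic intervals.\<close>
lemma positroid_basisI:
  fixes \<B> :: "'n::{finite,linorder} set set"
  assumes "positroid TYPE('d::{finite,linorder}) \<B>" "card B = CARD('d)"
    and ranks: "\<And>p q. card (B \<inter> cyclic_interval p q) \<le> rk \<B> (cyclic_interval p q)"
  shows "B \<in> \<B>"
proof (rule ccontr)
  assume "B \<notin> \<B>"
  interpret matroid \<B>
    by standard (use assms(1) in \<open>simp add: positroid_def\<close>)
  obtain B0 where "B0 \<in> \<B>" using bases unfolding matroid_bases_def by auto
  moreover have "\<forall>C. C \<in> \<B> \<longrightarrow> card (B \<inter> C) < Suc (card B)"
    by (simp add: card_mono less_Suc_eq_le)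
  ultimately have "\<exists>C. C \<in> \<B> \<and> (\<forall>C'. C' \<in> \<B> \<longrightarrow> card (B \<inter> C') \<le> card (B \<inter> C))"
    by (rule ex_has_greatest_nat)
  then obtain C where C: "C \<in> \<B>" and max: "\<And>C'. C' \<in> \<B> \<Longrightarrow> card (B \<inter> C') \<le> card (B \<inter> C)"
    by blast
  have cardC: "card C = CARD('d)" using positroid_card[OF assms(1) C] .
  have "\<not> C \<subseteq> B" using C \<open>B \<notin> \<B>\<close> cardC assms(2) by (metis card_subset_eq finite)
  then obtain a where a: "a \<in> C" "a \<notin> B" by blast
  \<comment> \<open>The fundamental cocircuit of \<open>a\<close> with respect to \<open>C\<close>:
    all elements that can replace \<open>a\<close>, including \<open>a\<close> itself.\<close>
  define D where "D = {e. insert e (C - {a}) \<in> \<B>}"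
  have "a \<in> D" using a C by (simp add: D_def insert_absorb)
  have DC: "e \<notin> C" if "e \<in> D" "e \<noteq> a" for e
  proof
    assume "e \<in> C"
    then have "C - {a} \<in> \<B>" using that by (simp add: D_def insert_absorb)
    then have "card (C - {a}) = card C" using C by (rule card_basis_eq)
    then show False using a(1) by (metis card_Diff1_less finite less_irrefl)
  qed
  \<comment> \<open>Replacing \<open>a\<close> by a point of \<open>B\<close> in \<open>D\<close>
    would give a basis with more elements in \<open>B\<close> than \<open>C\<close> has.\<close>
  have BD: "B \<inter> D = {}"
  proof (rule ccontr)
    assume "B \<inter> D \<noteq> {}"
    then obtain e where e: "e \<in> B" "e \<in> D" by blast
    then have "e \<notin> C" using DC a by blast
    have "B \<inter> insert e (C - {a}) = insert e (B \<inter> C)" using e a by blast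
    then have "card (insert e (B \<inter> C)) \<le> card (B \<inter> C)" using max e(2) by (metis D_def mem_Collect_eq)
    then show False using \<open>e \<notin> C\<close> by simp
  qed
  define J where "J = cut_arc a D ` (- D)"
  have "disjoint J" unfolding J_def disjoint_def cut_arc_def by auto
  have UJ: "\<Union>J = - D" unfolding J_def cut_arc_def by auto
  have "card (B \<inter> I) \<le> card (C \<inter> I)" if IJ: "I \<in> J" for I
  proof -
    obtain y where y: "I = cut_arc a D y" "y \<notin> D" using IJ unfolding J_def by blast
    \<comment> \<open>An exchange across the boundary of the arc would cross a chord from
      \<open>a\<close> to some \<open>e\<close> in \<open>D\<close>. Hence
      \<open>C \<inter> I\<close> spans the arc.\<close>
    have "insert f (C - {c}) \<notin> \<B>" if "f \<in> I - C" "c \<in> C - I" for f c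
    proof
      assume swap: "insert f (C - {c}) \<in> \<B>"
      have f: "f \<in> I" "f \<notin> C" "f \<notin> D" and c: "c \<in> C" "c \<notin> I"
        using that y(1) unfolding cut_arc_def by auto
      have "c \<noteq> a" using swap f unfolding D_def by blast
      then have "c \<notin> D" using c DC by blast
      then obtain e where e: "e \<in> D" "cyclic_le a e f \<noteq> cyclic_le a e c"
        using c(2) f(1) y(1) unfolding cut_arc_def by blast
      then have "e \<noteq> a" by auto
      then have "e \<notin> C" using DC e by blast
      have "(a < c \<longleftrightarrow> c < e) \<longleftrightarrow> (a < f \<longleftrightarrow> f < e)"
        by (rule positroid_noncrossing[OF assms(1) C a(1) c(1) _ \<open>e \<notin> C\<close> f(2)])
          (use \<open>c \<noteq> a\<close> e(1) f(3) swap in \<open>auto simp: D_def\<close>)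
      moreover have "distinct [a, e, f, c]"
        using \<open>c \<noteq> a\<close> \<open>e \<noteq> a\<close> \<open>e \<notin> C\<close> a(1) f c e(1) by auto
      ultimately show False using crossing_separates[OF e(2)] by blast
    qed
    then have "rk \<B> I = card (C \<inter> I)" by (rule rk_Int_basis[OF C])
    moreover obtain p q where "I = cyclic_interval p q"
      using cut_arc_is_cyclic_interval[OF y(2)] y(1) by metis
    ultimately show ?thesis using ranks[of p q] by simp
  qed
  then have "card (B \<inter> \<Union>J) \<le> card (C \<inter> \<Union>J)"
    unfolding card_Int_Union_disjoint[OF \<open>disjoint J\<close>] by (rule sum_mono)
  moreover have "B \<inter> \<Union>J = B" using BD unfolding UJ by blast
  \<comment> \<open>The arcs contain all of \<open>B\<close> but miss \<open>a\<close>, which makes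
    the final count strict.\<close>
  moreover have "C \<inter> \<Union>J \<subseteq> C - {a}" using \<open>a \<in> D\<close> unfolding UJ by blast
  ultimately have "card B \<le> card (C - {a})" by (metis card_mono finite order_trans)
  then show False using a(1) cardC assms(2) by (metis card_Diff1_less finite not_le)
qed

section \<open>Ranks and CCW-arrows\<close>

text \<open>Describes an arrow in the order based at its end \<open>i\<close>, the order in which
  the decorated permutation is defined.\<close>

lemma cyclic_interval_to_base:
  assumes "j \<noteq> i"
  shows "cyclic_interval j i = insert i {x. cyclic_le i j x}"
proof -
  have "cyclic_le j x i \<longleftrightarrow> x = i \<or> cyclic_le i j x" for x
    using assms unfolding cyclic_le_def by auto
  then show ?thesis unfolding cyclic_interval_def by blast
qed

section \<open>Decorated permutations and rank increments\<close>

locale loopless_coloopless_matroid = matroid \<B> for \<B> :: "'n::{finite,linorder} set set" +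
  assumes no_loop: "\<not> loop \<B> i" and no_coloop: "\<not> coloop \<B> i"
begin

abbreviation \<pi> :: "'n \<Rightarrow> 'n" where "\<pi> \<equiv> decorated_permutation \<B>"

lemma rk_singleton: "rk \<B> {i} = 1"
proof -
  obtain B where "B \<in> \<B>" "i \<in> B" using no_loop[of i] unfolding loop_def by blast
  then have "indep \<B> {i}" unfolding indep_def by blast
  then show ?thesis using card_le_rk[of "{i}" "{i}"] rk_le_card[of "{i}"] by simp
qed

lemma rk_delete: "rk \<B> (UNIV - {i}) = rk \<B> UNIV"
proof -
  obtain B where B: "B \<in> \<B>" "i \<notin> B" using no_coloop[of i] unfolding coloop_def by blast
  then have "card B \<le> rk \<B> (UNIV - {i})" by (intro card_le_rk) (auto simp: indep_def)
  then show ?thesis using rk_UNIV[OF B(1)] rk_mono[of "UNIV - {i}" UNIV] by simp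
qed

text \<open>Unfolds the definite description. A candidate exists because for the last element before
  \<open>i\<close> the interval is the whole ground set, and \<open>i\<close> is not a
  coloop.\<close>

lemma
  shows decorated_permutation_neq: "\<pi> i \<noteq> i"
    and decorated_permutation_rk: "rk \<B> (cyclic_interval i (\<pi> i)) = rk \<B> (cyclic_interval i (\<pi> i) - {i})"
    and decorated_permutation_least: "k \<noteq> i \<Longrightarrow> rk \<B> (cyclic_interval i k) = rk \<B> (cyclic_interval i k - {i})
      \<Longrightarrow> cyclic_le i (\<pi> i) k"
proof -
  define P where "P = (\<lambda>j. j \<noteq> i \<and> rk \<B> (cyclic_interval i j) = rk \<B> (cyclic_interval i j - {i}))"
  \<comment> \<open>On a one-element ground set the deletion of \<open>i\<close> would lower the
    rank from 1 to 0.\<close>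
  have "UNIV - {i} \<noteq> {}" using rk_delete[of i] rk_mono[of "{i}" UNIV] rk_singleton[of i] by force
  then obtain l where l: "l \<in> UNIV - {i}" "\<And>x. x \<in> UNIV - {i} \<Longrightarrow> cyclic_le i x l"
    using cyclic_greatest[of "UNIV - {i}" i] by (metis finite)
  then have "cyclic_interval i l = UNIV" unfolding cyclic_interval_def by fastforce
  then have "P l" using rk_delete[of i] l(1) unfolding P_def by simp
  then have "{j. P j} \<noteq> {}" by blast
  then obtain j where j: "P j" "\<And>k. P k \<Longrightarrow> cyclic_le i j k"
    using cyclic_least[of "{j. P j}" i] by (metis finite mem_Collect_eq)
  have "\<pi> i = (THE j. P j \<and> (\<forall>k. P k \<longrightarrow> cyclic_le i j k))"
    unfolding decorated_permutation_def Let_def P_def ..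
  also have "\<dots> = j" by (rule the_equality) (use j cyclic_le_antisym in blast)+
  finally have \<pi>: "\<pi> i = j" .
  show "\<pi> i \<noteq> i" and "rk \<B> (cyclic_interval i (\<pi> i)) = rk \<B> (cyclic_interval i (\<pi> i) - {i})"
    using j(1) unfolding \<pi> P_def by blast+
  show "cyclic_le i (\<pi> i) k"
    if "k \<noteq> i" "rk \<B> (cyclic_interval i k) = rk \<B> (cyclic_interval i k - {i})"
    using j(2)[of k] that unfolding \<pi> P_def by blast
qed

lemma rk_insert_eq:
  assumes "\<And>x. x \<noteq> i \<Longrightarrow> cyclic_le i x (\<pi> i) \<Longrightarrow> x \<in> X"
  shows "rk \<B> (insert i X) = rk \<B> X"
proof (rule rk_insert_eq_mono)
  show "cyclic_interval i (\<pi> i) - {i} \<subseteq> X" using assms unfolding cyclic_interval_def by blast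
  have "insert i (cyclic_interval i (\<pi> i) - {i}) = cyclic_interval i (\<pi> i)"
    unfolding cyclic_interval_def by auto
  then show "rk \<B> (insert i (cyclic_interval i (\<pi> i) - {i})) = rk \<B> (cyclic_interval i (\<pi> i) - {i})"
    using decorated_permutation_rk by simp
qed

text \<open>Such an \<open>X\<close> ends, seen from \<open>i\<close>, at some \<open>k\<close>
  before \<open>\<pi> i\<close>. If it spanned \<open>i\<close>, so would the elements after
  \<open>i\<close> up to \<open>k\<close>, although \<open>\<pi> i\<close> is the first place where
  this happens.\<close>

lemma rk_insert_Suc:
  assumes "X \<inter> cyclic_interval (\<pi> i) i = {}"
  shows "rk \<B> (insert i X) = Suc (rk \<B> X)"
proof (rule ccontr)
  assume "rk \<B> (insert i X) \<noteq> Suc (rk \<B> X)"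
  then have eq: "rk \<B> (insert i X) = rk \<B> X"
    using rk_insert_le[of i X] rk_mono[of X "insert i X"] by (simp add: subset_insertI)
  then have "X \<noteq> {}" using rk_singleton[of i] by auto
  then obtain k where k: "k \<in> X" "\<And>x. x \<in> X \<Longrightarrow> cyclic_le i x k"
    using cyclic_greatest[of X i] by (metis finite)
  have X: "x \<noteq> i" "\<not> cyclic_le i (\<pi> i) x" if "x \<in> X" for x
    using assms that cyclic_interval_to_base[OF decorated_permutation_neq] by auto
  have "X \<subseteq> cyclic_interval i k - {i}"
    using k(2) X(1) unfolding cyclic_interval_def by blast
  then have "rk \<B> (insert i (cyclic_interval i k - {i})) = rk \<B> (cyclic_interval i k - {i})"
    using eq by (rule rk_insert_eq_mono)
  moreover have "insert i (cyclic_interval i k - {i}) = cyclic_interval i k"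
    unfolding cyclic_interval_def by auto
  ultimately have "cyclic_le i (\<pi> i) k"
    using decorated_permutation_least[of k i] X(1)[OF k(1)] by simp
  then show False using X(2) k(1) by blast
qed

text \<open>Suppose \<open>i\<close> and \<open>k\<close> have the same image \<open>j\<close>, with
  \<open>k\<close> on the way from \<open>i\<close> to \<open>j\<close>. The points strictly between
  \<open>i\<close> and \<open>j\<close> span \<open>i\<close> only together with \<open>j\<close>,
  so they do not span \<open>j\<close>. But \<open>k\<close> and the points strictly between
  \<open>k\<close> and \<open>j\<close> already span \<open>j\<close>.\<close>

lemma inj_decorated_permutation: "inj \<pi>"
proof (rule injI, rule ccontr)
  have no: False if "i \<noteq> k" "\<pi> i = \<pi> k" "cyclic_le i k (\<pi> i)" for i k
  proof -
    define j where "j = \<pi> i"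
    have j: "j \<noteq> i" "j \<noteq> k" "\<pi> k = j" "\<pi> i = j"
      using decorated_permutation_neq[of i] decorated_permutation_neq[of k] that(2) by (auto simp: j_def)
    \<comment> \<open>\<open>X\<close> and \<open>Y\<close> are the open arcs from \<open>i\<close>
      to \<open>j\<close> and from \<open>k\<close> to \<open>j\<close>.\<close>
    define X where "X = - cyclic_interval j i"
    define Y where "Y = - cyclic_interval j k"
    have X: "x \<in> X \<longleftrightarrow> x \<noteq> i \<and> \<not> cyclic_le i j x" for x
      using cyclic_interval_to_base[OF j(1)] unfolding X_def by auto
    have Y: "x \<in> Y \<longleftrightarrow> x \<noteq> k \<and> \<not> cyclic_le k j x" for x
      using cyclic_interval_to_base[OF j(2)] unfolding Y_def by auto
    have ikj: "cyclic_le i k j" using that(3) j(4) by simp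
    have "k \<in> X" using X[of k] that(1) cyclic_le_antisym[OF ikj] j(2) by auto
    moreover have "x \<in> X" if "x \<in> Y" for x
    proof -
      have "x \<noteq> i \<and> \<not> cyclic_le i j x"
        using ikj j(1,2) \<open>i \<noteq> k\<close> that[unfolded Y] unfolding cyclic_le_def by auto
      then show ?thesis using X by blast
    qed
    ultimately have "insert k Y \<subseteq> X" by blast
    have "rk \<B> (insert i X) = Suc (rk \<B> X)"
      by (rule rk_insert_Suc) (use j in \<open>simp add: X_def\<close>)
    moreover have "rk \<B> (insert i (insert j X)) = rk \<B> (insert j X)"
    proof (rule rk_insert_eq)
      show "x \<in> insert j X" if "x \<noteq> i" "cyclic_le i x (\<pi> i)" for x
        using that cyclic_le_antisym[of i x j] X[of x] j(4) by auto
    qed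
    ultimately have *: "rk \<B> (insert j X) \<ge> Suc (rk \<B> X)"
      using rk_mono[of "insert i X" "insert i (insert j X)"] by auto
    have "rk \<B> (insert k Y) = Suc (rk \<B> Y)"
      by (rule rk_insert_Suc) (use j in \<open>simp add: Y_def\<close>)
    moreover have "rk \<B> (insert k (insert j Y)) = rk \<B> (insert j Y)"
    proof (rule rk_insert_eq)
      show "x \<in> insert j Y" if "x \<noteq> k" "cyclic_le k x (\<pi> k)" for x
        using that cyclic_le_antisym[of k x j] Y[of x] j(3) by auto
    qed
    moreover have "rk \<B> (insert k Y) \<le> rk \<B> (insert k (insert j Y))" by (rule rk_mono) blast
    ultimately have "rk \<B> (insert j (insert k Y)) = rk \<B> (insert k Y)"
      using rk_insert_le[of j Y] by (simp add: insert_commute[of j])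
    then have "rk \<B> (insert j X) = rk \<B> X"
      by (rule rk_insert_eq_mono[OF \<open>insert k Y \<subseteq> X\<close>])
    then show False using * by simp
  qed
  fix i k assume ik: "\<pi> i = \<pi> k" "i \<noteq> k"
  then have "cyclic_le i k (\<pi> i) \<or> cyclic_le k i (\<pi> i)"
    using decorated_permutation_neq[of i] decorated_permutation_neq[of k] unfolding cyclic_le_def by auto
  then show False using no[of i k] no[of k i] ik by auto
qed

lemma bij_decorated_permutation: "bij \<pi>"
  using inj_decorated_permutation by (simp add: bij_def finite_UNIV_inj_surj)

text \<open>Counts arrows by their end points, which removes the inverse of
  \<open>\<pi>\<close>.\<close>

lemma ccw_eq: "ccw \<pi> S = card {i. cyclic_interval (\<pi> i) i \<subseteq> S}"
proof -
  have "bij_betw \<pi> {i. cyclic_interval (\<pi> i) i \<subseteq> S} {x. ccw_arrow \<pi> x \<subseteq> S}"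
    using bij_betw_Collect[OF bij_decorated_permutation]
    by (simp add: ccw_arrow_def inv_f_f[OF inj_decorated_permutation])
  then show ?thesis unfolding ccw_def by (rule bij_betw_same_card[symmetric])
qed

text \<open>Add the elements of \<open>U\<close> to \<open>E\<close> from the last to the first in
  the order from \<open>e\<close>. An arrow ending at \<open>i\<close> that avoids \<open>E\<close>,
  hence \<open>e\<close>, lies between \<open>e\<close> and \<open>i\<close> and so misses
  everything added before \<open>i\<close>; thus \<open>i\<close> raises the rank.\<close>

lemma rk_Un_ge:
  assumes "e \<in> E" "U \<subseteq> - E"
  shows "rk \<B> E + card (U \<inter> {i. cyclic_interval (\<pi> i) i \<subseteq> - E}) \<le> rk \<B> (E \<union> U)"
    (is "_ + card (U \<inter> ?N) \<le> _")
  using finite[of U] assms(2)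
proof (induction U rule: finite_psubset_induct)
  case (psubset U)
  show ?case
  proof (cases "U = {}")
    case False
    then obtain i where i: "i \<in> U" "\<And>x. x \<in> U \<Longrightarrow> cyclic_le e i x"
      using cyclic_least[of U e] by (metis finite)
    define V where "V = U - {i}"
    have IH: "rk \<B> E + card (V \<inter> ?N) \<le> rk \<B> (E \<union> V)"
      using psubset i(1) unfolding V_def by blast
    have EU: "E \<union> U = insert i (E \<union> V)" using i(1) unfolding V_def by blast
    show ?thesis
    proof (cases "i \<in> ?N")
      case True
      have "(E \<union> V) \<inter> cyclic_interval (\<pi> i) i = {}"
      proof (rule ccontr)
        assume "(E \<union> V) \<inter> cyclic_interval (\<pi> i) i \<noteq> {}"
        then obtain x where x: "x \<in> V" "x \<in> cyclic_interval (\<pi> i) i" using True by blast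
        have "e \<notin> cyclic_interval (\<pi> i) i" using True assms(1) by blast
        then have "e \<noteq> i" "\<not> cyclic_le i (\<pi> i) e" "cyclic_le i (\<pi> i) x" "x \<noteq> i" "cyclic_le e i x"
          using x i(2) cyclic_interval_to_base[OF decorated_permutation_neq, of i] unfolding V_def by auto
        then show False unfolding cyclic_le_def by auto
      qed
      then have "rk \<B> (E \<union> U) = Suc (rk \<B> (E \<union> V))" unfolding EU by (rule rk_insert_Suc)
      moreover have "U \<inter> ?N = insert i (V \<inter> ?N)" "i \<notin> V" using True i(1) unfolding V_def by auto
      ultimately show ?thesis using IH by simp
    next
      case False
      then have "U \<inter> ?N = V \<inter> ?N" unfolding V_def by blast
      moreover have "rk \<B> (E \<union> V) \<le> rk \<B> (E \<union> U)" by (rule rk_mono) (auto simp: V_def)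
      ultimately show ?thesis using IH by simp
    qed
  qed simp
qed

text \<open>The last hypothesis makes \<open>U\<close> a final segment of the complement in the
  order from \<open>p\<close>. Elements are again added from the last to the first, and only one
  whose arrow avoids \<open>E\<close> can raise the rank.\<close>

lemma rk_cyclic_interval_Un_le:
  assumes E: "E = cyclic_interval p q" and "U \<subseteq> - E"
    and "\<And>x y. x \<in> U \<Longrightarrow> y \<notin> E \<Longrightarrow> cyclic_le p x y \<Longrightarrow> y \<in> U"
  shows "rk \<B> (E \<union> U) \<le> rk \<B> E + card (U \<inter> {i. cyclic_interval (\<pi> i) i \<subseteq> - E})"
    (is "_ \<le> _ + card (U \<inter> ?N)")
  using finite[of U] assms(2,3)
proof (induction U rule: finite_psubset_induct)
  case (psubset U)
  show ?case
  proof (cases "U = {}")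
    case False
    then obtain i where i: "i \<in> U" "\<And>x. x \<in> U \<Longrightarrow> cyclic_le p i x"
      using cyclic_least[of U p] by (metis finite)
    define V where "V = U - {i}"
    have IH: "rk \<B> (E \<union> V) \<le> rk \<B> E + card (V \<inter> ?N)"
    proof (rule psubset.IH)
      show "V \<subset> U" "V \<subseteq> - E" using i(1) psubset.prems(1) unfolding V_def by auto
      show "y \<in> V" if "x \<in> V" "y \<notin> E" "cyclic_le p x y" for x y
        using psubset.prems(2)[of x y] that i(2)[of x] cyclic_le_antisym[of p x y] unfolding V_def by auto
    qed
    have EU: "E \<union> U = insert i (E \<union> V)" using i(1) unfolding V_def by blast
    show ?thesis
    proof (cases "i \<in> ?N")
      case True
      then have "U \<inter> ?N = insert i (V \<inter> ?N)" "i \<notin> V" using i(1) unfolding V_def by auto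
      then show ?thesis using IH rk_insert_le[of i "E \<union> V"] unfolding EU by simp
    next
      case False
      have "i \<notin> E" using i(1) psubset.prems(1) by blast
      then obtain z where z: "z \<in> E" "cyclic_le i (\<pi> i) z"
        using False cyclic_interval_to_base[OF decorated_permutation_neq, of i] by auto
      \<comment> \<open>As the arrow meets \<open>E\<close>, the point \<open>\<pi> i\<close> comes
        no later than some \<open>z\<close> in \<open>E\<close>. The points after \<open>i\<close>
        up to \<open>z\<close> lie in \<open>V\<close> or in \<open>E\<close>, so \<open>i\<close>
        is already spanned.\<close>
      have "rk \<B> (insert i (E \<union> V)) = rk \<B> (E \<union> V)"
      proof (rule rk_insert_eq, rule ccontr)
        fix x assume x: "x \<noteq> i" "cyclic_le i x (\<pi> i)" "x \<notin> E \<union> V"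
        have "cyclic_le i x z" using cyclic_le_trans[OF x(2) z(2)] .
        moreover have "cyclic_le p z q" "\<not> cyclic_le p i q" "\<not> cyclic_le p x q"
          using z(1) \<open>i \<notin> E\<close> x(3) unfolding E cyclic_interval_def by auto
        ultimately have "cyclic_le p i x" using x(1) unfolding cyclic_le_def by auto
        then have "x \<in> U" using psubset.prems(2)[of i x] i(1) x(3) by blast
        then show False using x unfolding V_def by blast
      qed
      moreover have "U \<inter> ?N = V \<inter> ?N" using False unfolding V_def by blast
      ultimately show ?thesis using IH unfolding EU by simp
    qed
  qed simp
qed

lemma rk_ccw_le:
  assumes "E \<noteq> {}"
  shows "rk \<B> E + ccw \<pi> (- E) \<le> rk \<B> UNIV"
proof -
  obtain e where "e \<in> E" using assms by blast
  moreover have "i \<in> cyclic_interval (\<pi> i) i" for i by (simp add: cyclic_interval_def)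
  then have "- E \<inter> {i. cyclic_interval (\<pi> i) i \<subseteq> - E} = {i. cyclic_interval (\<pi> i) i \<subseteq> - E}"
    by blast
  ultimately show ?thesis using rk_Un_ge[of e E "- E"] by (simp add: ccw_eq)
qed

lemma rk_ccw_cyclic_interval:
  "rk \<B> (cyclic_interval p q) + ccw \<pi> (- cyclic_interval p q) = rk \<B> UNIV"
proof (rule antisym)
  let ?E = "cyclic_interval p q"
  have "- ?E \<inter> {i. cyclic_interval (\<pi> i) i \<subseteq> - ?E} \<subseteq> {i. cyclic_interval (\<pi> i) i \<subseteq> - ?E}" by blast
  then have "card (- ?E \<inter> {i. cyclic_interval (\<pi> i) i \<subseteq> - ?E}) \<le> ccw \<pi> (- ?E)"
    unfolding ccw_eq by (intro card_mono) auto
  then show "rk \<B> UNIV \<le> rk \<B> ?E + ccw \<pi> (- ?E)"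
    using rk_cyclic_interval_Un_le[OF refl, of "- ?E" p q] by simp
  have "p \<in> ?E" by (simp add: cyclic_interval_def)
  then show "rk \<B> ?E + ccw \<pi> (- ?E) \<le> rk \<B> UNIV" using rk_ccw_le[of ?E] by blast
qed

end

section \<open>Polytopes of intersecting submodular functions\<close>

text \<open>The empty set is left out because the function of the theorem takes the negative value
  \<open>d - n\<close> there: all \<open>n\<close> arrows lie in the ground set. Integer values
  avoid truncated subtraction and drive the integrality argument.\<close>

definition rank_polytope :: "('n::finite set \<Rightarrow> int) \<Rightarrow> (real ^ 'n) set" where
  "rank_polytope r =
    {x. (\<forall>i. 0 \<le> x $ i) \<and> (\<forall>E. E \<noteq> {} \<longrightarrow> (\<Sum>i\<in>E. x $ i) \<le> real_of_int (r E))}"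

lemma convex_rank_polytope: "convex (rank_polytope r)"
proof (rule convexI)
  fix x y :: "real ^ 'a" and u v :: real
  assume xy: "x \<in> rank_polytope r" "y \<in> rank_polytope r" and uv: "0 \<le> u" "0 \<le> v" "u + v = 1"
  have "(\<Sum>i\<in>E. (u *\<^sub>R x + v *\<^sub>R y) $ i) \<le> real_of_int (r E)" if "E \<noteq> {}" for E
  proof -
    have "(\<Sum>i\<in>E. (u *\<^sub>R x + v *\<^sub>R y) $ i) = u * (\<Sum>i\<in>E. x $ i) + v * (\<Sum>i\<in>E. y $ i)"
      by (simp add: sum.distrib sum_distrib_left)
    also have "\<dots> \<le> real_of_int (r E)"
      by (rule convex_bound_le) (use xy uv that in \<open>auto simp: rank_polytope_def\<close>)
    finally show ?thesis .
  qed
  then show "u *\<^sub>R x + v *\<^sub>R y \<in> rank_polytope r"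
    using xy uv unfolding rank_polytope_def by simp
qed

lemma compact_rank_polytope: "compact (rank_polytope r)"
proof -
  have "rank_polytope r =
      (\<Inter>i. {x. 0 \<le> x $ i}) \<inter> (\<Inter>E\<in>- {{}}. {x. (\<Sum>i\<in>E. x $ i) \<le> real_of_int (r E)})"
    unfolding rank_polytope_def by auto
  also have "closed \<dots>"
    by (intro closed_Int closed_INT ballI closed_Collect_le continuous_intros)
  finally have "closed (rank_polytope r)" .
  moreover have "\<bar>x $ i\<bar> \<le> (\<Sum>j\<in>UNIV. \<bar>real_of_int (r {j})\<bar>)" if "x \<in> rank_polytope r" for x i
  proof -
    have "0 \<le> x $ i" "x $ i \<le> real_of_int (r {i})"
      using that unfolding rank_polytope_def by (auto dest: spec[of _ "{i}"])
    moreover have "\<bar>real_of_int (r {i})\<bar> \<le> (\<Sum>j\<in>UNIV. \<bar>real_of_int (r {j})\<bar>)"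
      by (rule member_le_sum) auto
    ultimately show ?thesis by linarith
  qed
  then have "norm x \<le> (\<Sum>i::'a\<in>UNIV. \<Sum>j\<in>UNIV. \<bar>real_of_int (r {j})\<bar>)" if "x \<in> rank_polytope r" for x
    using that by (intro order_trans[OF norm_le_l1_cart] sum_mono)
  then have "bounded (rank_polytope r)" by (rule boundedI)
  ultimately show ?thesis by (simp add: compact_eq_bounded_closed)
qed

text \<open>Every constraint is either unaffected by a move along \<open>v\<close> or strict at
  \<open>x\<close>; as there are finitely many, small moves in both directions are allowed.\<close>

lemma rank_polytope_perturb:
  fixes x v :: "real ^ 'n::finite"
  assumes "x \<in> rank_polytope r"
    and pos: "\<And>i. v $ i \<noteq> 0 \<Longrightarrow> 0 < x $ i"
    and tight: "\<And>E. E \<noteq> {} \<Longrightarrow> (\<Sum>i\<in>E. x $ i) = real_of_int (r E) \<Longrightarrow> (\<Sum>i\<in>E. v $ i) = 0"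
  obtains t where "0 < t" "x + t *\<^sub>R v \<in> rank_polytope r" "x - t *\<^sub>R v \<in> rank_polytope r"
proof -
  have "eventually (\<lambda>t. 0 \<le> (x + t *\<^sub>R v) $ i) (nhds (0::real))" for i
  proof (cases "v $ i = 0")
    case True
    then show ?thesis using assms(1) by (simp add: rank_polytope_def)
  next
    case False
    have "((\<lambda>t. (x + t *\<^sub>R v) $ i) \<longlongrightarrow> (x + 0 *\<^sub>R v) $ i) (nhds (0::real))"
      by (intro tendsto_intros filterlim_ident)
    then have "eventually (\<lambda>t. 0 < (x + t *\<^sub>R v) $ i) (nhds (0::real))"
      by (rule order_tendstoD(1)) (use pos[OF False] in simp)
    then show ?thesis by (rule eventually_mono) simp
  qed
  moreover have "eventually (\<lambda>t. E \<noteq> {} \<longrightarrow> (\<Sum>i\<in>E. (x + t *\<^sub>R v) $ i) \<le> real_of_int (r E)) (nhds (0::real))" for E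
  proof (cases "E = {} \<or> (\<Sum>i\<in>E. x $ i) = real_of_int (r E)")
    case True
    then show ?thesis
    proof
      assume "(\<Sum>i\<in>E. x $ i) = real_of_int (r E)"
      moreover have "(\<Sum>i\<in>E. v $ i) = 0" if "E \<noteq> {}" using tight[OF that calculation] .
      ultimately have "E \<noteq> {} \<longrightarrow> (\<Sum>i\<in>E. (x + t *\<^sub>R v) $ i) \<le> real_of_int (r E)" for t
        by (simp add: sum.distrib sum_distrib_left[symmetric])
      then show ?thesis by (rule always_eventually[OF allI])
    qed simp
  next
    case False
    then have less: "(\<Sum>i\<in>E. x $ i) < real_of_int (r E)"
      using assms(1) by (simp add: rank_polytope_def order_less_le)
    have "((\<lambda>t. \<Sum>i\<in>E. (x + t *\<^sub>R v) $ i) \<longlongrightarrow> (\<Sum>i\<in>E. (x + 0 *\<^sub>R v) $ i)) (nhds (0::real))"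
      by (intro tendsto_intros filterlim_ident)
    then have "eventually (\<lambda>t. (\<Sum>i\<in>E. (x + t *\<^sub>R v) $ i) < real_of_int (r E)) (nhds (0::real))"
      by (rule order_tendstoD(2)) (use less in simp)
    then show ?thesis by (rule eventually_mono) simp
  qed
  ultimately have "eventually (\<lambda>t. x + t *\<^sub>R v \<in> rank_polytope r) (nhds (0::real))"
    unfolding rank_polytope_def mem_Collect_eq
    by (intro eventually_conj eventually_all_finite)
  then obtain d where "0 < d" and d: "\<And>t. \<bar>t\<bar> < d \<Longrightarrow> x + t *\<^sub>R v \<in> rank_polytope r"
    unfolding eventually_nhds_metric by (auto simp: dist_real_def)
  show ?thesis
    using that[of "d / 2"] d[of "d / 2"] d[of "- (d / 2)"] \<open>0 < d\<close> by simp
qed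

lemma extreme_rank_polytope_rigid:
  fixes x v :: "real ^ 'n::finite"
  assumes "x extreme_point_of rank_polytope r"
    and "\<And>i. v $ i \<noteq> 0 \<Longrightarrow> 0 < x $ i"
    and "\<And>E. E \<noteq> {} \<Longrightarrow> (\<Sum>i\<in>E. x $ i) = real_of_int (r E) \<Longrightarrow> (\<Sum>i\<in>E. v $ i) = 0"
  shows "v = 0"
proof (rule ccontr)
  assume "v \<noteq> 0"
  have "x \<in> rank_polytope r" using assms(1) by (simp add: extreme_point_of_def)
  then obtain t where t: "0 < t" "x + t *\<^sub>R v \<in> rank_polytope r" "x - t *\<^sub>R v \<in> rank_polytope r"
    using rank_polytope_perturb assms(2,3) by metis
  have "midpoint (x + t *\<^sub>R v) (x - t *\<^sub>R v) = x"
    by (simp add: midpoint_def scaleR_2[symmetric])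
  moreover have "x + t *\<^sub>R v \<noteq> x - t *\<^sub>R v"
  proof
    assume "x + t *\<^sub>R v = x - t *\<^sub>R v"
    then have "(2 * t) *\<^sub>R v = 0" by (simp add: algebra_simps scaleR_2[symmetric] flip: scaleR_scaleR)
    then show False using \<open>v \<noteq> 0\<close> t(1) by simp
  qed
  ultimately have "x \<in> open_segment (x + t *\<^sub>R v) (x - t *\<^sub>R v)"
    using midpoint_in_open_segment by metis
  then show False using assms(1) t unfolding extreme_point_of_def by blast
qed

text \<open>Sums are modular and \<open>r\<close> is submodular, so both bounds are attained. The
  value type is general because both real points and integer counts are uncrossed.\<close>

lemma tight_Un_Int:
  fixes x :: "'n::finite \<Rightarrow> 'a::linordered_idom" and r :: "'n set \<Rightarrow> int"
  assumes "r (E \<union> F) + r (E \<inter> F) \<le> r E + r F" "E \<inter> F \<noteq> {}"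
    and le: "\<And>E. E \<noteq> {} \<Longrightarrow> sum x E \<le> of_int (r E)"
    and "sum x E = of_int (r E)" "sum x F = of_int (r F)"
  shows "sum x (E \<union> F) = of_int (r (E \<union> F))" "sum x (E \<inter> F) = of_int (r (E \<inter> F))"
proof -
  have "sum x (E \<union> F) + sum x (E \<inter> F) = sum x E + sum x F" by (rule sum.union_inter) auto
  moreover have "(of_int (r (E \<union> F)) + of_int (r (E \<inter> F)) :: 'a) \<le> of_int (r E) + of_int (r F)"
    using assms(1) by (metis of_int_add of_int_le_iff)
  moreover have "sum x (E \<union> F) \<le> of_int (r (E \<union> F))" "sum x (E \<inter> F) \<le> of_int (r (E \<inter> F))"
    using assms(2) by (auto intro!: le)
  ultimately show "sum x (E \<union> F) = of_int (r (E \<union> F))" "sum x (E \<inter> F) = of_int (r (E \<inter> F))"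
    using assms(4,5) by linarith+
qed

text \<open>A fractional coordinate in no tight set could be moved alone. Otherwise a smallest tight
  set \<open>M\<close> through a fractional coordinate contains two of them, \<open>e\<close> and
  \<open>f\<close>, because its sum is an integer. By uncrossing, a tight set containing either
  contains \<open>M\<close>, so mass can be shifted between \<open>e\<close> and
  \<open>f\<close>.\<close>

lemma extreme_rank_polytope_integral:
  fixes x :: "real ^ 'n::finite"
  assumes submodular: "\<And>E F. E \<inter> F \<noteq> {} \<Longrightarrow> r (E \<union> F) + r (E \<inter> F) \<le> r E + r F"
    and extreme: "x extreme_point_of rank_polytope r"
  shows "x $ i \<in> \<int>"
proof (rule ccontr)
  assume i: "x $ i \<notin> \<int>"
  have x: "x \<in> rank_polytope r" using extreme by (simp add: extreme_point_of_def)
  have pos: "0 < x $ k" if "x $ k \<notin> \<int>" for k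
    using x that unfolding rank_polytope_def by (metis (mono_tags, lifting) Ints_0 mem_Collect_eq order_less_le)
  have le: "sum (($) x) E \<le> of_int (r E)" if "E \<noteq> {}" for E
    using x that unfolding rank_polytope_def by simp
  define T where "T = {E. E \<noteq> {} \<and> sum (($) x) E = of_int (r E)}"
  define P where "P = (\<lambda>(e, M). x $ e \<notin> \<int> \<and> M \<in> T \<and> e \<in> M)"
  have "\<exists>M. P (i, M)"
  proof (rule ccontr)
    assume "\<nexists>M. P (i, M)"
    then have out: "i \<notin> E" if "E \<in> T" for E using that i unfolding P_def by auto
    have "axis i 1 = (0 :: real ^ 'n)"
    proof (rule extreme_rank_polytope_rigid[OF extreme])
      show "0 < x $ k" if "axis i 1 $ k \<noteq> (0::real)" for k
        using that pos[OF i] by (simp add: axis_def split: if_splits)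
      show "(\<Sum>k\<in>E. axis i 1 $ k) = (0::real)" if "E \<noteq> {}" "(\<Sum>k\<in>E. x $ k) = of_int (r E)" for E
        using out[of E] that by (intro sum.neutral) (auto simp: T_def axis_def)
    qed
    then show False by (simp add: axis_eq_0_iff)
  qed
  then obtain M0 where "P (i, M0)" by blast
  then have "\<exists>p. P p \<and> (\<forall>q. P q \<longrightarrow> card (snd p) \<le> card (snd q))"
    by (rule ex_has_least_nat)
  then obtain e M where e: "x $ e \<notin> \<int>" "M \<in> T" "e \<in> M"
    and min: "\<And>e' M'. x $ e' \<notin> \<int> \<Longrightarrow> M' \<in> T \<Longrightarrow> e' \<in> M' \<Longrightarrow> card M \<le> card M'"
    unfolding P_def by fastforce
  have "\<exists>f\<in>M - {e}. x $ f \<notin> \<int>"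
  proof (rule ccontr)
    assume "\<not> ?thesis"
    then have "sum (($) x) (M - {e}) \<in> \<int>" by (intro Ints_sum) blast
    moreover have "sum (($) x) M \<in> \<int>" using e(2) unfolding T_def by simp
    moreover have "x $ e = sum (($) x) M - sum (($) x) (M - {e})"
      using e(3) by (simp add: sum_diff1)
    ultimately show False using e(1) by simp
  qed
  then obtain f where f: "f \<in> M" "f \<noteq> e" "x $ f \<notin> \<int>" by blast
  have sub: "M \<subseteq> E" if "E \<in> T" "k \<in> E" "k \<in> M" "x $ k \<notin> \<int>" for E k
  proof -
    have ne: "M \<inter> E \<noteq> {}" using that by blast
    have "sum (($) x) (M \<inter> E) = of_int (r (M \<inter> E))"
      by (rule tight_Un_Int(2)[OF submodular[OF ne] ne le]) (use e that in \<open>auto simp: T_def\<close>)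
    then have "card M \<le> card (M \<inter> E)" using min[of k "M \<inter> E"] that ne unfolding T_def by blast
    then show ?thesis by (metis card_seteq finite inf.cobounded1 inf.absorb_iff1)
  qed
  have "axis e 1 - axis f 1 = (0 :: real ^ 'n)"
  proof (rule extreme_rank_polytope_rigid[OF extreme])
    show "0 < x $ k" if "(axis e 1 - axis f 1) $ k \<noteq> (0::real)" for k
      using that pos[OF e(1)] pos[OF f(3)] by (auto simp: axis_def split: if_splits)
    fix E assume "E \<noteq> {}" "(\<Sum>k\<in>E. x $ k) = of_int (r E)"
    then have "E \<in> T" unfolding T_def by simp
    then have "e \<in> E \<longleftrightarrow> f \<in> E" using sub[of E e] sub[of E f] e f by blast
    moreover have "(\<Sum>k\<in>E. axis j 1 $ k) = (if j \<in> E then 1 else 0 :: real)" for j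
      by (simp add: axis_def)
    ultimately show "(\<Sum>k\<in>E. (axis e 1 - axis f 1) $ k) = (0::real)"
      by (simp add: sum_subtractf)
  qed
  then show False using f(2) by (simp add: axis_eq_axis)
qed

text \<open>For a maximal \<open>J\<close> every element lies in a tight set, so by uncrossing the maximal tight sets
  partition the ground set; summing over them compares \<open>J\<close> with any other feasible set.\<close>
lemma extend_feasible_set:
  fixes r :: "'n::finite set \<Rightarrow> int"
  assumes submodular: "\<And>E F. E \<inter> F \<noteq> {} \<Longrightarrow> r (E \<union> F) + r (E \<inter> F) \<le> r E + r F"
    and singleton: "\<And>i. r {i} \<le> 1"
    and I: "\<And>E. E \<noteq> {} \<Longrightarrow> int (card (I \<inter> E)) \<le> r E"
    and C: "\<And>E. E \<noteq> {} \<Longrightarrow> int (card (C \<inter> E)) \<le> r E"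
  obtains J where "I \<subseteq> J" "card C \<le> card J" "\<And>E. E \<noteq> {} \<Longrightarrow> int (card (J \<inter> E)) \<le> r E"
proof -
  define P where "P = (\<lambda>J. I \<subseteq> J \<and> (\<forall>E. E \<noteq> {} \<longrightarrow> int (card (J \<inter> E)) \<le> r E))"
  have "P I" using I unfolding P_def by blast
  moreover have "\<forall>J. P J \<longrightarrow> card J < Suc (card (UNIV :: 'n set))"
    by (simp add: card_mono less_Suc_eq_le)
  ultimately have "\<exists>J. P J \<and> (\<forall>K. P K \<longrightarrow> card K \<le> card J)"
    by (rule ex_has_greatest_nat)
  then obtain J where J: "I \<subseteq> J" and le: "\<And>E. E \<noteq> {} \<Longrightarrow> int (card (J \<inter> E)) \<le> r E"
    and max: "\<And>K. P K \<Longrightarrow> card K \<le> card J"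
    unfolding P_def by blast
  \<comment> \<open>The tight sets for \<open>J\<close>.\<close>
  define T where "T = {E. E \<noteq> {} \<and> int (card (J \<inter> E)) = r E}"
  have card_sum: "int (card (J \<inter> E)) = (\<Sum>i\<in>E. if i \<in> J then 1 else 0)" for E
    by (simp add: sum.If_cases Int_commute)
  have T_Un: "E \<union> F \<in> T" if "E \<in> T" "F \<in> T" "E \<inter> F \<noteq> {}" for E F
    using tight_Un_Int(1)[OF submodular[OF that(3)] that(3), of "\<lambda>i. if i \<in> J then 1 else (0::int)"] le that
    unfolding T_def card_sum by simp
  have cover: "\<exists>E\<in>T. i \<in> E" for i
  proof (cases "i \<in> J")
    case True
    then have "{i} \<in> T" using le[of "{i}"] singleton[of i] unfolding T_def by simp
    then show ?thesis by blast
  next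
    case False
    \<comment> \<open>By maximality, adding \<open>i\<close> violates some constraint; since both
      sides are integers, that constraint is tight for \<open>J\<close>.\<close>
    then have "\<not> P (insert i J)" using max[of "insert i J"] by auto
    then obtain E where E: "E \<noteq> {}" "r E < int (card (insert i J \<inter> E))"
      using J unfolding P_def by (auto simp: not_le)
    then have "i \<in> E" using le[of E] by (cases "i \<in> E") auto
    then have "r E \<le> int (card (J \<inter> E))" using E(2) False by simp
    then show ?thesis using le[OF E(1)] E(1) \<open>i \<in> E\<close> unfolding T_def by auto
  qed
  define M where "M = {E \<in> T. \<forall>F\<in>T. E \<subseteq> F \<longrightarrow> F = E}"
  have "disjoint M"
    unfolding disjoint_def
  proof (intro ballI impI, rule ccontr)
    fix E F assume EF: "E \<in> M" "F \<in> M" "E \<noteq> F" "E \<inter> F \<noteq> {}"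
    then have "E \<union> F \<in> T" using T_Un unfolding M_def by blast
    then have "E \<union> F = E" "E \<union> F = F" using EF unfolding M_def by blast+
    then show False using EF(3) by blast
  qed
  have "i \<in> \<Union>M" for i
  proof -
    obtain E where E: "E \<in> T" "i \<in> E" using cover by blast
    then obtain F where "F \<in> T" "E \<subseteq> F" "\<And>G. G \<in> T \<Longrightarrow> F \<subseteq> G \<Longrightarrow> G = F"
      using finite_has_maximal2[of T E] by (metis finite)
    then show ?thesis using E unfolding M_def by blast
  qed
  then have UM: "\<Union>M = UNIV" by blast
  have "int (card C) = (\<Sum>E\<in>M. int (card (C \<inter> E)))"
    using card_Int_Union_disjoint[OF \<open>disjoint M\<close>, of C] unfolding UM by simp
  also have "\<dots> \<le> (\<Sum>E\<in>M. int (card (J \<inter> E)))"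
    by (rule sum_mono) (use C in \<open>auto simp: M_def T_def\<close>)
  also have "\<dots> = int (card J)"
    using card_Int_Union_disjoint[OF \<open>disjoint M\<close>, of J] unfolding UM by simp
  finally show ?thesis using that[of J] J le by simp
qed

section \<open>The independent set polytope of a positroid\<close>

text \<open>An arrow inside \<open>S\<close> or \<open>T\<close> is inside the union, and one inside
  both is inside the intersection.\<close>

lemma ccw_supermodular:
  fixes \<pi> :: "'n::{finite,linorder} \<Rightarrow> 'n"
  shows "ccw \<pi> S + ccw \<pi> T \<le> ccw \<pi> (S \<union> T) + ccw \<pi> (S \<inter> T)"
proof -
  let ?A = "\<lambda>S. {x. ccw_arrow \<pi> x \<subseteq> S}"
  have "ccw \<pi> S + ccw \<pi> T = card (?A S \<union> ?A T) + card (?A S \<inter> ?A T)"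
    unfolding ccw_def by (rule card_Un_Int) auto
  also have "card (?A S \<union> ?A T) \<le> ccw \<pi> (S \<union> T)"
    unfolding ccw_def by (rule card_mono) auto
  also have "?A S \<inter> ?A T = ?A (S \<inter> T)" by auto
  finally show ?thesis by (simp add: ccw_def)
qed

text \<open>Shrinking the complement of \<open>E\<close> to the union of the arrows it contains keeps the right-hand
  side and enlarges the left-hand side, so the covered complements suffice.\<close>
lemma covered_inequalities_suffice:
  fixes \<pi> :: "'n::{finite,linorder} \<Rightarrow> 'n" and x :: "(real, 'n) vec"
  assumes nonneg: "\<And>i. 0 \<le> x $ i"
    and covered: "\<And>E. E \<noteq> {} \<Longrightarrow> ccw_covered \<pi> (- E) \<Longrightarrow> (\<Sum>l\<in>E. x $ l) \<le> d - real (ccw \<pi> (- E))"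
    and "E \<noteq> {}"
  shows "(\<Sum>l\<in>E. x $ l) \<le> d - real (ccw \<pi> (- E))"
proof -
  define S where "S = \<Union> (ccw_arrow \<pi> ` {x. ccw_arrow \<pi> x \<subseteq> - E})"
  have arrows: "ccw_arrow \<pi> x \<subseteq> S \<longleftrightarrow> ccw_arrow \<pi> x \<subseteq> - E" for x
    unfolding S_def by blast
  have "E \<subseteq> - S" unfolding S_def by blast
  then have "(\<Sum>l\<in>E. x $ l) \<le> (\<Sum>l\<in>- S. x $ l)"
    by (intro sum_mono2) (use nonneg in auto)
  also have "\<dots> \<le> d - real (ccw \<pi> (- (- S)))"
  proof (rule covered)
    show "ccw_covered \<pi> (- (- S))"
      using arrows unfolding ccw_covered_def double_complement by (auto simp: S_def)
    show "- S \<noteq> {}" using \<open>E \<subseteq> - S\<close> assms(3) by blast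
  qed
  also have "ccw \<pi> (- (- S)) = ccw \<pi> (- E)" by (simp add: ccw_def arrows)
  finally show ?thesis .
qed

theorem theorem5p2:
  fixes \<B> :: "'n::{finite,linorder} set set"
    and \<pi> :: "'n \<Rightarrow> 'n"
  assumes "positroid TYPE('d::{finite,linorder}) \<B>"
    and "\<And>i. \<not> loop \<B> i"
    and "\<And>i. \<not> coloop \<B> i"
    and "\<pi> = decorated_permutation \<B>"
  shows "independent_set_polytope \<B> =
    {x :: (real, 'n) vec.
       (\<forall>i. 0 \<le> x $ i) \<and>
       (\<forall>E. E \<noteq> {} \<and> ccw_covered \<pi> (- E) \<longrightarrow>
          (\<Sum>l\<in>E. x $ l) \<le> real CARD('d) - real (ccw \<pi> (- E)))}"
proof -
  interpret loopless_coloopless_matroid \<B>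
    by standard (use assms(1-3) in \<open>simp_all add: positroid_def\<close>)
  define r where "r = (\<lambda>E. int CARD('d) - int (ccw \<pi> (- E)))"
  obtain C where C: "C \<in> \<B>" using bases unfolding matroid_bases_def by auto
  have d: "rk \<B> UNIV = CARD('d)" using rk_UNIV[OF C] positroid_card[OF assms(1) C] by simp
  have rk_le: "int (rk \<B> E) \<le> r E" if "E \<noteq> {}" for E
    using rk_ccw_le[OF that] d by (simp add: r_def assms(4))
  have rk_interval: "int (rk \<B> (cyclic_interval p q)) = r (cyclic_interval p q)" for p q
    using rk_ccw_cyclic_interval[of p q] d by (simp add: r_def assms(4))
  have card_le: "int (card (I \<inter> E)) \<le> r E" if "indep \<B> I" "E \<noteq> {}" for I E
  proof -
    have "card (I \<inter> E) \<le> rk \<B> E" by (rule card_le_rk) (use that(1) in \<open>auto intro: indep_mono\<close>)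
    then show ?thesis using rk_le[OF that(2)] by simp
  qed
  have submodular: "r (E \<union> F) + r (E \<inter> F) \<le> r E + r F" for E F
    using ccw_supermodular[of \<pi> "- E" "- F"] by (simp add: r_def)
  have singleton: "r {i} \<le> 1" for i
  proof -
    have "{i} = cyclic_interval i i" by (auto simp: cyclic_interval_def cyclic_le_def)
    then show ?thesis using rk_interval[of i i] rk_singleton[of i] by simp
  qed
  have component: "(\<Sum>i\<in>I. axis i 1) $ j = (if j \<in> I then 1 else 0 :: real)" for I and j :: 'n
    by (simp add: axis_def)
  have card_sum: "(\<Sum>j\<in>E. (\<Sum>i\<in>I. axis i 1) $ j) = real (card (I \<inter> E))" for I E :: "'n set"
    unfolding component by (simp add: sum.If_cases Int_commute)

  have "independent_set_polytope \<B> \<subseteq> rank_polytope r"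
    unfolding independent_set_polytope_def
  proof (rule hull_minimal)
    show "{\<Sum>i\<in>I. axis i 1 |I. indep \<B> I} \<subseteq> rank_polytope r"
    proof
      fix x :: "(real, 'n) vec" assume "x \<in> {\<Sum>i\<in>I. axis i 1 |I. indep \<B> I}"
      then obtain I where I: "x = (\<Sum>i\<in>I. axis i 1)" "indep \<B> I" by blast
      have "0 \<le> x $ j" for j unfolding I(1) component by simp
      moreover have "(\<Sum>j\<in>E. x $ j) \<le> real_of_int (r E)" if "E \<noteq> {}" for E
        unfolding I(1) card_sum using card_le[OF I(2) that] by linarith
      ultimately show "x \<in> rank_polytope r" unfolding rank_polytope_def by blast
    qed
  qed (rule convex_rank_polytope)
  moreover have "rank_polytope r \<subseteq> independent_set_polytope \<B>"
  proof -
    have "{x. x extreme_point_of rank_polytope r} \<subseteq> {\<Sum>i\<in>I. axis i 1 |I. indep \<B> I}"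
    proof
      fix x assume "x \<in> {x. x extreme_point_of rank_polytope r}"
      then have ext: "x extreme_point_of rank_polytope r" by simp
      then have x: "x \<in> rank_polytope r" by (simp add: extreme_point_of_def)
      have zero_one: "x $ i = 0 \<or> x $ i = 1" for i
      proof -
        obtain k where k: "x $ i = of_int k"
          using extreme_rank_polytope_integral[OF submodular ext] by (auto elim: Ints_cases)
        have "0 \<le> x $ i" "(\<Sum>j\<in>{i}. x $ j) \<le> real_of_int (r {i})"
          using x unfolding rank_polytope_def by blast+
        then have "0 \<le> x $ i" "x $ i \<le> 1" using singleton[of i] by auto
        then show ?thesis unfolding k by auto
      qed
      define I where "I = {i. x $ i = 1}"
      have xI: "x = (\<Sum>i\<in>I. axis i 1)"
        unfolding vec_eq_iff component using zero_one by (auto simp: I_def)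
      have I: "int (card (I \<inter> E)) \<le> r E" if "E \<noteq> {}" for E
      proof -
        have "(\<Sum>j\<in>E. x $ j) \<le> real_of_int (r E)" using x that unfolding rank_polytope_def by blast
        then show ?thesis unfolding xI card_sum by linarith
      qed
      have "indep \<B> C" using C unfolding indep_def by blast
      \<comment> \<open>The basis \<open>C\<close> is itself feasible, so \<open>I\<close> extends
        to a feasible set with at least \<open>d\<close> elements.\<close>
      obtain J where J: "I \<subseteq> J" "card C \<le> card J" "\<And>E. E \<noteq> {} \<Longrightarrow> int (card (J \<inter> E)) \<le> r E"
        using extend_feasible_set[OF submodular singleton I card_le[OF \<open>indep \<B> C\<close>]] by blast
      have "J \<in> \<B>"
      proof (rule positroid_basisI[OF assms(1)])
        have "card J \<le> CARD('d)" using J(3)[of UNIV] by (simp add: r_def)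
        then show "card J = CARD('d)" using J(2) positroid_card[OF assms(1) C] by simp
        show "card (J \<inter> cyclic_interval p q) \<le> rk \<B> (cyclic_interval p q)" for p q
        proof -
          have "cyclic_interval p q \<noteq> {}" unfolding cyclic_interval_def by (auto intro: exI[of _ p])
          then show ?thesis using J(3)[of "cyclic_interval p q"] rk_interval[of p q] by simp
        qed
      qed
      then have "indep \<B> I" using J(1) unfolding indep_def by blast
      then show "x \<in> {\<Sum>i\<in>I. axis i 1 |I. indep \<B> I}" using xI by blast
    qed
    then have "convex hull {x. x extreme_point_of rank_polytope r} \<subseteq> independent_set_polytope \<B>"
      unfolding independent_set_polytope_def by (rule hull_mono)
    \<comment> \<open>A compact convex set in finite dimension is the convex hull of its extreme
      points.\<close>
    then show ?thesis
      unfolding Krein_Milman_Minkowski[OF compact_rank_polytope convex_rank_polytope, of r, symmetric] .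
  qed
  moreover have "rank_polytope r = {x. (\<forall>i. 0 \<le> x $ i) \<and>
       (\<forall>E. E \<noteq> {} \<and> ccw_covered \<pi> (- E) \<longrightarrow>
          (\<Sum>l\<in>E. x $ l) \<le> real CARD('d) - real (ccw \<pi> (- E)))}" (is "_ = ?R")
  proof
    show "rank_polytope r \<subseteq> ?R" unfolding rank_polytope_def r_def by auto
    show "?R \<subseteq> rank_polytope r"
    proof
      fix x assume x: "x \<in> ?R"
      have "(\<Sum>l\<in>E. x $ l) \<le> real CARD('d) - real (ccw \<pi> (- E))" if "E \<noteq> {}" for E
        by (rule covered_inequalities_suffice[OF _ _ that]) (use x in auto)
      then show "x \<in> rank_polytope r" using x unfolding rank_polytope_def r_def by simp
    qed
  qed
  ultimately show ?thesis by simp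
qed

end
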